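(* Let $(G,a,b)$ be an $n$-isobicyclic triple with $n=2^e\ge 4$, where $G$ is not metacyclic. (i) If $e=2$ then $G$ has, in terms of the generators $a,b$, the presentation $$G=\langle a,b\mid a^4=b^4=[a^2,b]=[b^2,a]=1,\ [b,a]=a^2b^2\rangle\cong G_2(2;0,0).$$ (ii) If $e\ge 3$ then there exist $k,l\in\{0,1\}$ such that $G$ has, in terms of the generators $a,b$, the presentation $$\begin{aligned}G=\langle a,b\mid\ & a^n=b^n=[b^2,a^2]=1,\ [b,a]=a^2b^{-2}(a^{n/2}b^{n/2})^k,\\ & (b^2)^a=b^{-2}(a^{n/2}b^{n/2})^l,\ (a^2)^b=a^{-2}(a^{n/2}b^{n/2})^l\rangle\cong G_2(e;k,l).\end{aligned}$$
   Context: Conventions: $x^y=y^{-1}xy$ and $[x,y]=x^{-1}y^{-1}xy$. A group is metacyclic if it has a cyclic normal subgroup with cyclic quotient. An $n$-isobicyclic triple $(G,a,b)$ consists of a finite group $G$ and elements $a,b\in G$ of order $n$ such that $G=\langle a\rangle\langle b\rangle$, $\langle a\rangle\cap\langle b\rangle=1$, and there is an automorphism of $G$ transposing $a$ and $b$. For $n=2^e\ge 4$ and $k,l\in\{0,1\}$ (with $k=l=0$ when $n=4$), $G_2(e;k,l)$ is the group defined by $$G_2(e;k,l)=\langle a,b\mid a^n=b^n=[b^2,a^2]=1,\ [b,a]=a^2b^{-2}(a^{n/2}b^{n/2})^k,\ (b^2)^a=b^{-2}(a^{n/2}b^{n/2})^l,\ (a^2)^b=a^{-2}(a^{n/2}b^{n/2})^l\rangle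 .$$ *)

theory Defs
  imports "HOL-Algebra.Algebra"
begin

text \<open>The letter \<open>(x, True)\<close> stands for the generator \<open>x\<close> and \<open>(x, False)\<close> for its formal inverse.\<close>

inductive free_eq :: "('g \<times> bool) list \<Rightarrow> ('g \<times> bool) list \<Rightarrow> bool" where
  cancel: "free_eq (u @ [(x, s), (x, \<not> s)] @ v) (u @ v)"
| refl: "free_eq u u"
| sym: "free_eq u v \<Longrightarrow> free_eq v u"
| trans: "free_eq u v \<Longrightarrow> free_eq v w \<Longrightarrow> free_eq u w"

definition free_rel :: "(('g \<times> bool) list \<times> ('g \<times> bool) list) set" where
  "free_rel = {(u, v). free_eq u v}"

definition free_group :: "('g \<times> bool) list set monoid" where
  "free_group = \<lparr> carrier = UNIV // free_rel,
     monoid.mult = (\<lambda>U V. \<Union>u\<in>U. \<Union>v\<in>V. free_rel `` {u @ v}),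
     one = free_rel `` {[]} \<rparr>"

definition free_gen :: "'g \<Rightarrow> ('g \<times> bool) list set" where
  "free_gen x = free_rel `` {[(x, True)]}"

definition normal_closure :: "('a, 'm) monoid_scheme \<Rightarrow> 'a set \<Rightarrow> 'a set" where
  "normal_closure G S =
     generate G {inv\<^bsub>G\<^esub> g \<otimes>\<^bsub>G\<^esub> s \<otimes>\<^bsub>G\<^esub> g | g s. g \<in> carrier G \<and> s \<in> S}"

text \<open>A relation \<open>u = v\<close> between elements of the free group is encoded as the pair \<open>(u, v)\<close>,
  with relator \<open>u v\<^sup>-\<^sup>1\<close>. The generating set is the whole type \<open>'g\<close>.\<close>

definition relators :: "(('g \<times> bool) list set \<times> ('g \<times> bool) list set) set
    \<Rightarrow> ('g \<times> bool) list set set" where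
  "relators R = {u \<otimes>\<^bsub>free_group\<^esub> inv\<^bsub>free_group\<^esub> v | u v. (u, v) \<in> R}"

definition presented_group :: "(('g \<times> bool) list set \<times> ('g \<times> bool) list set) set
    \<Rightarrow> ('g \<times> bool) list set set monoid" where
  "presented_group R = free_group Mod normal_closure free_group (relators R)"

definition presented_gen :: "(('g \<times> bool) list set \<times> ('g \<times> bool) list set) set
    \<Rightarrow> 'g \<Rightarrow> ('g \<times> bool) list set set" where
  "presented_gen R x = normal_closure free_group (relators R) #>\<^bsub>free_group\<^esub> free_gen x"

text \<open>\<open>G\<close> has the presentation with relations \<open>R\<close> in terms of the elements \<open>f x\<close>: the assignment
  \<open>x \<mapsto> f x\<close> induces an isomorphism from the presented group onto \<open>G\<close>.\<close>

definition has_presentation :: "('a, 'm) monoid_scheme \<Rightarrow> ('g \<Rightarrow> 'a)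
    \<Rightarrow> (('g \<times> bool) list set \<times> ('g \<times> bool) list set) set \<Rightarrow> bool" where
  "has_presentation G f R \<longleftrightarrow>
     (\<exists>\<phi>\<in>iso (presented_group R) G. \<forall>x. \<phi> (presented_gen R x) = f x)"

definition metacyclic :: "('a, 'm) monoid_scheme \<Rightarrow> bool" where
  "metacyclic G \<longleftrightarrow>
     (\<exists>N. N \<lhd> G \<and> cyclic_group (subgroup_generated G N) \<and> cyclic_group (G Mod N))"

definition isobicyclic_triple :: "nat \<Rightarrow> ('a, 'm) monoid_scheme \<Rightarrow> 'a \<Rightarrow> 'a \<Rightarrow> bool" where
  "isobicyclic_triple n G a b \<longleftrightarrow>
     group G \<and> finite (carrier G) \<and> a \<in> carrier G \<and> b \<in> carrier G \<and>
     group.ord G a = n \<and> group.ord G b = n \<and>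
     carrier G = generate G {a} <#>\<^bsub>G\<^esub> generate G {b} \<and>
     generate G {a} \<inter> generate G {b} = {\<one>\<^bsub>G\<^esub>} \<and>
     (\<exists>\<alpha>\<in>iso G G. \<alpha> a = b \<and> \<alpha> b = a)"

definition grp_conj :: "('a, 'm) monoid_scheme \<Rightarrow> 'a \<Rightarrow> 'a \<Rightarrow> 'a" where
  "grp_conj G x y = inv\<^bsub>G\<^esub> y \<otimes>\<^bsub>G\<^esub> x \<otimes>\<^bsub>G\<^esub> y"

definition grp_comm :: "('a, 'm) monoid_scheme \<Rightarrow> 'a \<Rightarrow> 'a \<Rightarrow> 'a" where
  "grp_comm G x y = inv\<^bsub>G\<^esub> x \<otimes>\<^bsub>G\<^esub> inv\<^bsub>G\<^esub> y \<otimes>\<^bsub>G\<^esub> x \<otimes>\<^bsub>G\<^esub> y"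

datatype gen = Gen_a | Gen_b

definition G2_rels :: "nat \<Rightarrow> nat \<Rightarrow> nat \<Rightarrow>
    ((gen \<times> bool) list set \<times> (gen \<times> bool) list set) set" where
  "G2_rels e k l =
    (let F = free_group; a = free_gen Gen_a; b = free_gen Gen_b; n = (2::nat) ^ e;
         z = a [^]\<^bsub>F\<^esub> (n div 2) \<otimes>\<^bsub>F\<^esub> b [^]\<^bsub>F\<^esub> (n div 2)
     in { (a [^]\<^bsub>F\<^esub> n, \<one>\<^bsub>F\<^esub>),
          (b [^]\<^bsub>F\<^esub> n, \<one>\<^bsub>F\<^esub>),
          (grp_comm F (b [^]\<^bsub>F\<^esub> (2::nat)) (a [^]\<^bsub>F\<^esub> (2::nat)), \<one>\<^bsub>F\<^esub>),
          (grp_comm F b a, a [^]\<^bsub>F\<^esub> (2::nat) \<otimes>\<^bsub>F\<^esub> b [^]\<^bsub>F\<^esub> (-2::int) \<otimes>\<^bsub>F\<^esub> z [^]\<^bsub>F\<^esub> k),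
          (grp_conj F (b [^]\<^bsub>F\<^esub> (2::nat)) a, b [^]\<^bsub>F\<^esub> (-2::int) \<otimes>\<^bsub>F\<^esub> z [^]\<^bsub>F\<^esub> l),
          (grp_conj F (a [^]\<^bsub>F\<^esub> (2::nat)) b, a [^]\<^bsub>F\<^esub> (-2::int) \<otimes>\<^bsub>F\<^esub> z [^]\<^bsub>F\<^esub> l) })"

definition G2 :: "nat \<Rightarrow> nat \<Rightarrow> nat \<Rightarrow> (gen \<times> bool) list set set monoid" where
  "G2 e k l = presented_group (G2_rels e k l)"

definition order4_rels :: "((gen \<times> bool) list set \<times> (gen \<times> bool) list set) set" where
  "order4_rels =
    (let F = free_group; a = free_gen Gen_a; b = free_gen Gen_b
     in { (a [^]\<^bsub>F\<^esub> (4::nat), \<one>\<^bsub>F\<^esub>),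
          (b [^]\<^bsub>F\<^esub> (4::nat), \<one>\<^bsub>F\<^esub>),
          (grp_comm F (a [^]\<^bsub>F\<^esub> (2::nat)) b, \<one>\<^bsub>F\<^esub>),
          (grp_comm F (b [^]\<^bsub>F\<^esub> (2::nat)) a, \<one>\<^bsub>F\<^esub>),
          (grp_comm F b a, a [^]\<^bsub>F\<^esub> (2::nat) \<otimes>\<^bsub>F\<^esub> b [^]\<^bsub>F\<^esub> (2::nat)) })"

lemma equiv_free_rel: "equiv UNIV free_rel"
  by (rule equivI) (auto simp: free_rel_def refl_on_def sym_def trans_def
      intro: free_eq.refl free_eq.sym free_eq.trans)

lemma free_class_eq_iff: "free_rel `` {u} = free_rel `` {v} \<longleftrightarrow> free_eq u v"
  using eq_equiv_class_iff[OF equiv_free_rel] by (simp add: free_rel_def)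

lemma free_eq_append_left: "free_eq u v \<Longrightarrow> free_eq (w @ u) (w @ v)"
proof (induction rule: free_eq.induct)
  case (cancel u x s v)
  show ?case using free_eq.cancel[of "w @ u" x s v] by simp
qed (auto intro: free_eq.refl free_eq.sym free_eq.trans)

lemma free_eq_append_right: "free_eq u v \<Longrightarrow> free_eq (u @ w) (v @ w)"
proof (induction rule: free_eq.induct)
  case (cancel u x s v)
  show ?case using free_eq.cancel[of u x s "v @ w"] by simp
qed (auto intro: free_eq.refl free_eq.sym free_eq.trans)

lemma free_mult_class:
  "free_rel `` {u} \<otimes>\<^bsub>free_group\<^esub> free_rel `` {v} = free_rel `` {u @ v}"
proof -
  have "congruent2 free_rel free_rel (\<lambda>u v. free_rel `` {u @ v})"
    by (rule congruent2I[OF equiv_free_rel equiv_free_rel])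
       (simp_all add: free_class_eq_iff, simp_all add: free_rel_def
         free_eq_append_left free_eq_append_right)
  from UN_equiv_class2[OF equiv_free_rel equiv_free_rel this, of u v]
  show ?thesis by (simp add: free_group_def)
qed

lemma free_eq_inverse:
  "free_eq (rev (map (\<lambda>(x, s). (x, \<not> s)) u) @ u) []"
proof (induction u)
  case Nil
  show ?case by (simp add: free_eq.refl)
next
  case (Cons p u)
  obtain x s where p: "p = (x, s)" by force
  let ?i = "rev (map (\<lambda>(x, s). (x, \<not> s)) u)"
  have "free_eq (?i @ [(x, \<not> s), (x, \<not> \<not> s)] @ u) (?i @ u)"
    by (rule free_eq.cancel)
  with Cons.IH show ?case by (auto simp: p intro: free_eq.trans)
qed

lemma group_free_group: "group free_group"
proof (rule groupI)
  have cls: "\<exists>u. U = free_rel `` {u}" if "U \<in> carrier free_group" for U :: "('g \<times> bool) list set"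
    using that by (auto simp: free_group_def quotient_def)
  have mem: "free_rel `` {u} \<in> carrier free_group" for u :: "('g \<times> bool) list"
    by (auto simp: free_group_def quotient_def)
  have one: "\<one>\<^bsub>free_group\<^esub> = free_rel `` {[] :: ('g \<times> bool) list}"
    by (simp add: free_group_def)
  fix U V W :: "('g \<times> bool) list set"
  assume U: "U \<in> carrier free_group"
  then obtain u where u: "U = free_rel `` {u}" using cls by blast
  show "\<one>\<^bsub>free_group\<^esub> \<otimes>\<^bsub>free_group\<^esub> U = U"
    by (simp add: u one free_mult_class)
  show "\<exists>V\<in>carrier free_group. V \<otimes>\<^bsub>free_group\<^esub> U = \<one>\<^bsub>free_group\<^esub>"
  proof (rule bexI[OF _ mem])
    show "free_rel `` {rev (map (\<lambda>(x, s). (x, \<not> s)) u)} \<otimes>\<^bsub>free_group\<^esub> U = \<one>\<^bsub>free_group\<^esub>"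
      by (simp add: u one free_mult_class free_class_eq_iff free_eq_inverse)
  qed
  assume V: "V \<in> carrier free_group"
  then obtain v where v: "V = free_rel `` {v}" using cls by blast
  show "U \<otimes>\<^bsub>free_group\<^esub> V \<in> carrier free_group"
    by (simp add: u v free_mult_class mem)
  assume "W \<in> carrier free_group"
  then obtain w where w: "W = free_rel `` {w}" using cls by blast
  show "U \<otimes>\<^bsub>free_group\<^esub> V \<otimes>\<^bsub>free_group\<^esub> W = U \<otimes>\<^bsub>free_group\<^esub> (V \<otimes>\<^bsub>free_group\<^esub> W)"
    by (simp add: u v w free_mult_class)
next
  show "\<one>\<^bsub>free_group\<^esub> \<in> carrier free_group"
    by (auto simp: free_group_def quotient_def)
qed

lemma (in group) normal_normal_closure:
  assumes S: "S \<subseteq> carrier G"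
  shows "normal_closure G S \<lhd> G"
  unfolding normal_closure_def
proof (rule normal_generateI)
  show "{inv g \<otimes> s \<otimes> g | g s. g \<in> carrier G \<and> s \<in> S} \<subseteq> carrier G"
    using S by auto
next
  fix h g
  assume "h \<in> {inv g \<otimes> s \<otimes> g | g s. g \<in> carrier G \<and> s \<in> S}" and g: "g \<in> carrier G"
  then obtain g' s where h: "h = inv g' \<otimes> s \<otimes> g'" "g' \<in> carrier G" "s \<in> S" by blast
  then have "g \<otimes> h \<otimes> inv g = inv (g' \<otimes> inv g) \<otimes> s \<otimes> (g' \<otimes> inv g)"
    using S g by (simp add: inv_mult_group m_assoc subset_iff)
  with h g show "g \<otimes> h \<otimes> inv g \<in> {inv g \<otimes> s \<otimes> g | g s. g \<in> carrier G \<and> s \<in> S}"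
    by blast
qed

lemma group_presented_group:
  assumes "R \<subseteq> carrier free_group \<times> carrier free_group"
  shows "group (presented_group R)"
proof -
  interpret F: group free_group by (rule group_free_group)
  have "relators R \<subseteq> carrier free_group"
    using assms by (auto simp: relators_def)
  then show ?thesis
    unfolding presented_group_def by (intro normal.factorgroup_is_group F.normal_normal_closure)
qed

end

theory Submission
  imports Defs
begin

text \<open>
  Counting shows that \<open>a\<^bsup>n/2\<^esup>\<close> and \<open>b\<^bsup>n/2\<^esup>\<close> are central, so \<open>N = {1, a\<^bsup>n/2\<^esup>, b\<^bsup>n/2\<^esup>, z}\<close> with
  \<open>z = a\<^bsup>n/2\<^esup> b\<^bsup>n/2\<^esup>\<close> is a central subgroup with \<open>n/2\<close>-isobicyclic quotient. By induction on \<open>e\<close>,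
  either \<open>h = a\<^sup>-\<^sup>1 b\<close> generates a normal subgroup, with cyclic quotient because \<open>b = a h\<close>, or the
  relations of \<open>G\<^sub>2(e; k, l)\<close> hold. In the step, the relations of the quotient lift to \<open>G\<close> up to
  factors in \<open>N\<close>; the automorphism exchanging \<open>a\<close> and \<open>b\<close> forces these factors to be fixed by it,
  that is, to lie in \<open>{1, z}\<close>, and forces the parameters of the quotient to be \<open>0\<close>. Finally, the
  relations rewrite every word to some \<open>a\<^sup>i b\<^sup>j\<close>, so the presented group is no larger than \<open>G\<close>.
\<close>

section \<open>Isobicyclic groups and their central quotients\<close>

text \<open>\<open>N\<close> is invariant under \<alpha>, so the quotient inherits the swap. As
  \<alpha> exchanges two of the three involutions of \<open>N\<close>, only \<open>z\<close> is
  fixed, which is why no other error term occurs in the relations of \<open>G2_rels\<close>. The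
  element \<open>h\<close> suits the swap because \<alpha> inverts it and because
  \<open>b = a h\<close> makes conjugation by \<open>b\<close> and by \<open>a\<close> agree on
  \<open>h\<close>; comparing the two determines the error in the conjugate of \<open>h\<close>.
  Vanishing parameters of the quotient do not make those of \<open>G\<close> vanish: the new
  \<open>k\<close> and \<open>l\<close> are the exponents of the error terms \<open>z^k\<close>,
  \<open>z^l\<close> met in the lifting, created afresh at each step. The obstacle is that the
  \<open>z\<close> of the quotient lifts to \<open>c = a^(n/4) b^(n/4)\<close>, a square root of
  \<open>z\<close> that commutes with squares but perhaps not with \<open>a\<close> and
  \<open>b\<close>. The contradictions drawn from this use that 8 divides \<open>n/2\<close>, so
  \<open>k = l = 0\<close> at order 4 is carried through the induction as separate information. In
  the presented group the centrality of \<open>z\<close> cannot be borrowed from \<open>G\<close>;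
  it is derived from the relations, using \<open>8 dvd n\<close> when \<open>l\<close> is not
  0.\<close>

lemma int_dvd_diff_imp_eq:
  assumes "int n dvd int x - int y" "x < n" "y < n"
  shows "x = y"
  using assms mod_eq_dvd_iff[of "int x" "int n" "int y"] by simp

section \<open>Conjugation and commutation rules in a group\<close>

context group begin

lemma inv_mult_cancel: "x \<in> carrier G \<Longrightarrow> y \<in> carrier G \<Longrightarrow> inv x \<otimes> (x \<otimes> y) = y"
  by (simp flip: m_assoc)

lemma mult_inv_cancel: "x \<in> carrier G \<Longrightarrow> y \<in> carrier G \<Longrightarrow> x \<otimes> (inv x \<otimes> y) = y"
  by (simp flip: m_assoc)

lemmas word_simps = m_assoc inv_mult_group inv_mult_cancel mult_inv_cancel

lemma grp_conj_closed [simp]: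
  "x \<in> carrier G \<Longrightarrow> g \<in> carrier G \<Longrightarrow> grp_conj G x g \<in> carrier G"
  by (simp add: grp_conj_def)

lemma grp_conj_mult:
  "x \<in> carrier G \<Longrightarrow> y \<in> carrier G \<Longrightarrow> g \<in> carrier G \<Longrightarrow>
    grp_conj G (x \<otimes> y) g = grp_conj G x g \<otimes> grp_conj G y g"
  by (simp add: grp_conj_def word_simps)

lemma grp_conj_one [simp]: "g \<in> carrier G \<Longrightarrow> grp_conj G \<one> g = \<one>"
  by (simp add: grp_conj_def)

lemma grp_conj_inv:
  "x \<in> carrier G \<Longrightarrow> g \<in> carrier G \<Longrightarrow> grp_conj G (inv x) g = inv (grp_conj G x g)"
  by (simp add: grp_conj_def word_simps)

lemma grp_conj_pow:
  "x \<in> carrier G \<Longrightarrow> g \<in> carrier G \<Longrightarrow> grp_conj G (x [^] (k::nat)) g = grp_conj G x g [^] k"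
  by (induction k) (simp_all add: grp_conj_mult)

lemma grp_conj_int_pow:
  "x \<in> carrier G \<Longrightarrow> g \<in> carrier G \<Longrightarrow> grp_conj G (x [^] (k::int)) g = grp_conj G x g [^] k"
  by (cases k rule: int_cases2) (simp_all add: int_pow_int int_pow_neg_int grp_conj_pow grp_conj_inv)

lemma grp_conj_conj:
  "x \<in> carrier G \<Longrightarrow> g \<in> carrier G \<Longrightarrow> h \<in> carrier G \<Longrightarrow>
    grp_conj G (grp_conj G x g) h = grp_conj G x (g \<otimes> h)"
  by (simp add: grp_conj_def word_simps)

lemma grp_conj_eq_iff:
  "x \<in> carrier G \<Longrightarrow> y \<in> carrier G \<Longrightarrow> g \<in> carrier G \<Longrightarrow>
    grp_conj G x g = y \<longleftrightarrow> x \<otimes> g = g \<otimes> y"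
  by (metis (no_types, lifting) grp_conj_def inv_closed m_assoc m_closed inv_mult_cancel mult_inv_cancel)

lemma grp_conj_eq_self:
  "x \<in> carrier G \<Longrightarrow> g \<in> carrier G \<Longrightarrow> x \<otimes> g = g \<otimes> x \<Longrightarrow> grp_conj G x g = x"
  by (simp add: grp_conj_eq_iff)

lemma commute_pow_right:
  assumes "x \<in> carrier G" "y \<in> carrier G" "x \<otimes> y = y \<otimes> x"
  shows "x \<otimes> y [^] (k::nat) = y [^] k \<otimes> x"
proof (induction k)
  case (Suc k)
  have "x \<otimes> y [^] Suc k = (x \<otimes> y [^] k) \<otimes> y" using assms by (simp add: m_assoc)
  also have "\<dots> = y [^] k \<otimes> (x \<otimes> y)" using assms by (simp add: Suc m_assoc)
  also have "\<dots> = y [^] Suc k \<otimes> x" using assms by (simp add: m_assoc)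
  finally show ?case .
qed (use assms in simp)

lemma commute_pow_pow:
  assumes "x \<in> carrier G" "y \<in> carrier G" "x \<otimes> y = y \<otimes> x"
  shows "x [^] (j::nat) \<otimes> y [^] (k::nat) = y [^] k \<otimes> x [^] j"
  using commute_pow_right[OF assms] commute_pow_right[of "y [^] k" x j] assms by simp

end

text \<open>That \<open>\<alpha>\<close> is bijective follows, so a homomorphism is all that has to be checked for quotients.\<close>

locale isobicyclic = group G for G (structure) +
  fixes n :: nat and a b :: 'a and \<alpha> :: "'a \<Rightarrow> 'a"
  assumes a_closed [simp]: "a \<in> carrier G" and b_closed [simp]: "b \<in> carrier G"
    and a_pow_eq_one_iff: "\<And>i::nat. a [^] i = \<one> \<longleftrightarrow> n dvd i"
    and b_pow_eq_one_iff: "\<And>i::nat. b [^] i = \<one> \<longleftrightarrow> n dvd i"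
    and factorization: "\<And>x. x \<in> carrier G \<Longrightarrow> \<exists>(i::nat) (j::nat). x = a [^] i \<otimes> b [^] j"
    and pow_eq_imp_one: "\<And>(i::nat) (j::nat). a [^] i = b [^] j \<Longrightarrow> a [^] i = \<one>"
    and n_pos: "n > 0"
    and swap_hom: "\<alpha> \<in> hom G G"
    and swap_a [simp]: "\<alpha> a = b" and swap_b [simp]: "\<alpha> b = a"

sublocale isobicyclic \<subseteq> swap: group_hom G G \<alpha>
  using swap_hom by unfold_locales (auto simp: hom_def)

section \<open>Counting in a product of two cyclic groups\<close>

context isobicyclic begin

lemma factorization_unique:
  fixes i j :: nat
  assumes "a [^] i \<otimes> b [^] j = \<one>"
  shows "a [^] i = \<one>" "b [^] j = \<one>"
proof -
  \<comment> \<open>The exponent \<open>(n - 1) * j\<close> stands for \<open>- j\<close> modulo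
    \<open>n\<close>, since \<open>pow_eq_imp_one\<close> speaks of natural exponents only.\<close>
  have "b [^] j \<otimes> b [^] ((n - 1) * j) = \<one>"
    using n_pos by (simp add: nat_pow_mult b_pow_eq_one_iff flip: add_mult_distrib mult_Suc)
  with assms have "a [^] i = b [^] ((n - 1) * j)"
    by (metis a_closed b_closed inv_equality inv_unique nat_pow_closed inv_char)
  from pow_eq_imp_one[OF this] show "a [^] i = \<one>" .
  with assms show "b [^] j = \<one>" by simp
qed

lemma pow_mod: "a [^] (i::nat) = a [^] (i mod n)" "b [^] (i::nat) = b [^] (i mod n)"
proof -
  have "a [^] (n * (i div n) + i mod n) = a [^] (i mod n)"
    "b [^] (n * (i div n) + i mod n) = b [^] (i mod n)"
    by (simp_all only: nat_pow_mult[symmetric] a_closed b_closed)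
       (simp_all add: a_pow_eq_one_iff[THEN iffD2] b_pow_eq_one_iff[THEN iffD2])
  then show "a [^] i = a [^] (i mod n)" "b [^] i = b [^] (i mod n)"
    by (simp_all only: mult_div_mod_eq)
qed

lemma carrier_subset: "carrier G \<subseteq> (\<lambda>(i, j). a [^] i \<otimes> b [^] j) ` ({..<n} \<times> {..<n})"
proof
  fix x assume "x \<in> carrier G"
  then obtain i j :: nat where "x = a [^] i \<otimes> b [^] j" using factorization by blast
  then have "x = a [^] (i mod n) \<otimes> b [^] (j mod n)" using pow_mod by metis
  then show "x \<in> (\<lambda>(i, j). a [^] i \<otimes> b [^] j) ` ({..<n} \<times> {..<n})"
    using n_pos by (intro image_eqI[of _ _ "(i mod n, j mod n)"]) simp_all
qed

lemma finite_carrier: "finite (carrier G)"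
  using carrier_subset by (rule finite_subset) simp

lemma card_carrier_le: "card (carrier G) \<le> n * n"
  using card_mono[OF _ carrier_subset] card_image_le[of "{..<n} \<times> {..<n}" "\<lambda>(i, j). a [^] i \<otimes> b [^] j"]
  by (simp add: card_cartesian_product)

lemma a_int_pow_eq_one_iff: "a [^] (i::int) = \<one> \<longleftrightarrow> int n dvd i"
  by (cases i rule: int_cases2) (auto simp: int_pow_int int_pow_neg_int a_pow_eq_one_iff)

lemma a_int_pow_eq_iff: "a [^] (i::int) = a [^] (j::int) \<longleftrightarrow> int n dvd i - j"
  by (metis a_closed a_int_pow_eq_one_iff int_pow_closed int_pow_diff inv_closed inv_inv inv_unique r_inv inv_equality)

lemma central_mono:
  assumes "x \<in> carrier G" "a \<otimes> x = x \<otimes> a" "b \<otimes> x = x \<otimes> b" "y \<in> carrier G"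
  shows "y \<otimes> x = x \<otimes> y"
proof -
  obtain i j :: nat where y: "y = a [^] i \<otimes> b [^] j" using factorization assms by blast
  have "x \<otimes> a [^] i = a [^] i \<otimes> x" "x \<otimes> b [^] j = b [^] j \<otimes> x"
    using assms commute_pow_right by auto
  then show ?thesis using assms(1) unfolding y by (metis a_closed b_closed nat_pow_closed m_assoc)
qed

text \<open>The group cannot be the product of \<open>\<langle>a\<rangle>\<close> and its conjugate \<open>\<langle>a\<rangle>\<^sup>b\<close>, so by counting these two
  cyclic 2-groups intersect nontrivially and hence share their involution.\<close>

lemma half_pow_commute:
  assumes n: "n = 2 ^ Suc f"
  shows "b \<otimes> a [^] (2 ^ f :: nat) = a [^] (2 ^ f :: nat) \<otimes> b"
proof -
  \<comment> \<open>The image is the double coset of \<open>inv b\<close> modulo the powers of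
    \<open>a\<close>. It misses 1, because \<open>b\<close> is no power of \<open>a\<close>, so it
    has fewer than \<open>n * n\<close> elements and \<open>F\<close> is not injective.\<close>
  define F where "F = (\<lambda>(x::nat, y::nat). a [^] x \<otimes> inv b \<otimes> a [^] y)"
  let ?D = "{..<n} \<times> {..<n}"
  have F_closed: "F ` ?D \<subseteq> carrier G" by (auto simp: F_def)
  have "\<one> \<notin> F ` ?D"
  proof
    assume "\<one> \<in> F ` ?D"
    then obtain x y :: nat where "a [^] x \<otimes> inv b \<otimes> a [^] y = \<one>" by (auto simp: F_def)
    then have "inv (a [^] x \<otimes> inv b) = a [^] y"
      by (metis a_closed b_closed inv_closed inv_equality inv_inv m_closed nat_pow_closed)
    then have "b \<otimes> inv (a [^] x) = a [^] y" by (simp add: inv_mult_group)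
    then have "b = a [^] y \<otimes> a [^] x"
      by (metis a_closed b_closed inv_closed inv_solve_right nat_pow_closed)
    then have ab: "a [^] (y + x) = b [^] (1::nat)" by (simp add: nat_pow_mult)
    with pow_eq_imp_one have "b [^] (1::nat) = \<one>" by metis
    then have "n dvd 1" by (simp only: b_pow_eq_one_iff)
    with n show False by simp
  qed
  with F_closed have "F ` ?D \<subset> carrier G" by auto
  then have "card (F ` ?D) < card (carrier G)" by (rule psubset_card_mono[OF finite_carrier])
  then have "card (F ` ?D) \<noteq> card ?D" using card_carrier_le by (simp add: card_cartesian_product)
  then have "\<not> inj_on F ?D" using card_image by blast
  then obtain p p' where p: "p \<in> ?D" "p' \<in> ?D" "p \<noteq> p'" "F p = F p'"
    by (auto simp only: inj_on_def)
  obtain x y x' y' where pp: "p = (x, y)" "p' = (x', y')" by (cases p, cases p')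
  have xy: "x < n" "y < n" "x' < n" "y' < n" "(x, y) \<noteq> (x', y')"
    and eq: "a [^] x \<otimes> inv b \<otimes> a [^] y = a [^] x' \<otimes> inv b \<otimes> a [^] y'"
    using p by (simp_all add: pp F_def)
  define s t where "s = int y - int y'" and "t = int x' - int x"
  \<comment> \<open>A collision of \<open>F\<close> says that some nontrivial power of
    \<open>a\<close> is conjugated by \<open>b\<close> to a power of \<open>a\<close>.\<close>
  have conj: "grp_conj G (a [^] s) b = a [^] t"
  proof -
    have "inv b \<otimes> a [^] y = inv (a [^] x) \<otimes> (a [^] x' \<otimes> inv b \<otimes> a [^] y')"
      unfolding eq[symmetric] by (simp add: word_simps)
    then have "inv b \<otimes> a [^] y \<otimes> inv (a [^] y') = inv (a [^] x) \<otimes> a [^] x' \<otimes> inv b"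
      by (simp add: word_simps)
    moreover have "a [^] s = a [^] y \<otimes> inv (a [^] y')"
      by (simp add: s_def int_pow_diff int_pow_int)
    moreover have "a [^] t = inv (a [^] x) \<otimes> a [^] x'"
      by (simp add: t_def int_pow_mult int_pow_neg_int int_pow_int flip: uminus_add_conv_diff)
    ultimately show ?thesis by (simp add: grp_conj_def m_assoc)
  qed
  have s: "\<not> int n dvd s"
  proof
    assume dvd: "int n dvd s"
    with xy have "y = y'" by (intro int_dvd_diff_imp_eq) (simp_all add: s_def)
    then have "a [^] t = \<one>" using conj by (simp add: s_def)
    then have dvd: "int n dvd t" by (simp add: a_int_pow_eq_one_iff)
    with xy have "x' = x" by (intro int_dvd_diff_imp_eq) (simp_all add: t_def)
    with \<open>y = y'\<close> xy show False by simp
  qed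
  define m :: nat where "m = 2 ^ f"
  have nm: "n = 2 * m" by (simp add: n m_def)
  \<comment> \<open>As \<open>n\<close> is a power of 2 that does not divide \<open>s\<close>, the
    gcd is a proper divisor of \<open>n\<close> and hence divides \<open>n/2\<close>. Bezout then
    writes the involution \<open>a^m\<close> as a power of \<open>a^s\<close>.\<close>
  have "gcd s (int n) dvd int m"
  proof -
    obtain g where g: "gcd s (int n) = int g" by (metis gcd_ge_0_int nonneg_int_cases)
    have "int g dvd int n" unfolding g[symmetric] by simp
    then have "g dvd 2 ^ Suc f" unfolding n by (simp only: int_dvd_int_iff)
    then obtain i where i: "i \<le> Suc f" "g = 2 ^ i" using divides_primepow_nat[OF two_is_prime_nat] by blast
    have "i \<noteq> Suc f"
      using g i n s gcd_dvd1[of s "int n"] by auto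
    then show ?thesis using g i by (simp add: m_def le_imp_power_dvd)
  qed
  then obtain q where q: "int m = gcd s (int n) * q" by (elim dvdE)
  obtain u v where uv: "u * s + v * int n = gcd s (int n)" using bezout_int by blast
  have k: "int m - s * (u * q) = int n * (v * q)"
    unfolding q uv[symmetric] by (simp add: algebra_simps)
  have am: "a [^] int m = (a [^] s) [^] (u * q)"
    by (simp add: int_pow_pow a_int_pow_eq_iff k)
  define r where "r = t * (u * q)"
  have "grp_conj G (a [^] m) b = grp_conj G (a [^] s) b [^] (u * q)"
    unfolding int_pow_int[symmetric] am by (simp only: grp_conj_int_pow int_pow_closed a_closed b_closed)
  also have "\<dots> = a [^] r" by (simp add: conj int_pow_pow r_def)
  finally have c: "grp_conj G (a [^] m) b = a [^] r" .
  \<comment> \<open>The conjugate \<open>a^r\<close> of the involution \<open>a^m\<close> squares to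
    1, so it is 1 or \<open>a^m\<close>; conjugation being injective, it is not 1.\<close>
  have "a [^] (r * int 2) = (a [^] r) [^] (2::nat)"
    by (simp only: int_pow_pow[symmetric] int_pow_int a_closed)
  also have "\<dots> = grp_conj G (a [^] (m * 2)) b"
    by (simp only: c[symmetric] nat_pow_pow[symmetric] grp_conj_pow nat_pow_closed a_closed b_closed)
  also have "a [^] (m * 2) = \<one>" by (simp add: a_pow_eq_one_iff nm mult.commute)
  finally have "int n dvd r * 2" by (simp add: a_int_pow_eq_one_iff)
  then have "int m dvd r" by (simp add: nm mult.commute)
  then obtain d where d: "r = int m * d" by (elim dvdE)
  have "odd d"
  proof
    assume "even d"
    then have "int n dvd r" unfolding d nm by auto
    then have "grp_conj G (a [^] m) b = \<one>" using c a_int_pow_eq_one_iff by simp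
    then have "a [^] m = \<one>" by (simp add: grp_conj_eq_iff)
    then show False using n_pos by (auto simp: a_pow_eq_one_iff nm dest!: dvd_imp_le)
  qed
  then obtain d' where "d = 2 * d' + 1" by (elim oddE)
  then have "r - int m = int n * d'" unfolding d nm by (simp add: algebra_simps)
  then have "a [^] r = a [^] int m" unfolding a_int_pow_eq_iff by simp
  then have "grp_conj G (a [^] m) b = a [^] m" using c by (simp add: int_pow_int)
  then show ?thesis by (simp add: grp_conj_eq_iff m_def)
qed

end


text \<open>The induction ranges over groups of one fixed type, so \<open>G Mod N\<close> is transported to a set of coset
  representatives.\<close>

lemma (in group) quotient_on_representatives:
  assumes "N \<lhd> G"
  shows "\<exists>(H :: ('a, 'b) monoid_scheme) \<phi>. group H \<and> \<phi> \<in> hom G H \<and> carrier H = \<phi> ` carrier G \<and>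
    carrier H \<subseteq> carrier G \<and>
    (\<forall>x\<in>carrier G. \<forall>y\<in>carrier G. \<phi> x = \<phi> y \<longleftrightarrow> N #> x = N #> y) \<and>
    (\<forall>x\<in>carrier G. \<phi> (\<phi> x) = \<phi> x)"
proof -
  interpret normal N G by fact
  define \<phi> where "\<phi> x = (SOME y. y \<in> N #> x)" for x
  have \<phi>_mem: "\<phi> x \<in> N #> x" if "x \<in> carrier G" for x
    unfolding \<phi>_def by (rule someI[of _ x]) (use rcos_self[OF that] is_subgroup in blast)
  have \<phi>_closed [simp]: "\<phi> x \<in> carrier G" if "x \<in> carrier G" for x
    using \<phi>_mem[OF that] r_coset_subset_G[OF subset that] by blast
  have coset_\<phi>: "N #> \<phi> x = N #> x" if "x \<in> carrier G" for x
    using repr_independence[OF \<phi>_mem[OF that] that is_subgroup] by simp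
  \<comment> \<open>The choice sees only the coset as a set, so equal cosets receive the same
    representative.\<close>
  have \<phi>_eq: "\<phi> x = \<phi> y \<longleftrightarrow> N #> x = N #> y" if "x \<in> carrier G" "y \<in> carrier G" for x y
    using coset_\<phi> that by (metis \<phi>_def)
  have \<phi>_mult: "\<phi> (\<phi> x \<otimes> y) = \<phi> (x \<otimes> y)" "\<phi> (x \<otimes> \<phi> y) = \<phi> (x \<otimes> y)"
    if "x \<in> carrier G" "y \<in> carrier G" for x y
    using that by (simp_all add: \<phi>_eq coset_\<phi> flip: rcos_sum)
  define H :: "('a, 'b) monoid_scheme" where
    "H = G\<lparr>carrier := \<phi> ` carrier G, monoid.mult := \<lambda>x y. \<phi> (x \<otimes> y), one := \<phi> \<one>\<rparr>"
  have "group H"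
  proof (rule groupI)
    fix x y z assume "x \<in> carrier H" "y \<in> carrier H" "z \<in> carrier H"
    then show "x \<otimes>\<^bsub>H\<^esub> y \<otimes>\<^bsub>H\<^esub> z = x \<otimes>\<^bsub>H\<^esub> (y \<otimes>\<^bsub>H\<^esub> z)"
      by (auto simp: H_def \<phi>_mult m_assoc)
  next
    fix x assume "x \<in> carrier H"
    then obtain y where "y \<in> carrier G" "x = \<phi> y" by (auto simp: H_def)
    then show "\<exists>y\<in>carrier H. y \<otimes>\<^bsub>H\<^esub> x = \<one>\<^bsub>H\<^esub>"
      by (auto simp: H_def \<phi>_mult intro!: bexI[of _ "inv y"])
  qed (auto simp: H_def \<phi>_mult)
  moreover have "\<phi> \<in> hom G H" by (auto simp: hom_def H_def \<phi>_mult)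
  moreover have "\<phi> (\<phi> x) = \<phi> x" if "x \<in> carrier G" for x
    using that by (simp add: \<phi>_eq coset_\<phi>)
  ultimately show ?thesis
    by (intro exI[of _ H] exI[of _ \<phi>]) (auto simp: \<phi>_eq H_def)
qed

section \<open>The central four-group \<open>N\<close> and the quotient by it\<close>

locale isobicyclic_half = isobicyclic +
  fixes f m :: nat
  assumes n_eq: "n = 2 * m" and m_eq: "m = 2 ^ f"
begin

definition "za = a [^] m"
definition "zb = b [^] m"
definition "z = za \<otimes> zb"
definition "N = {\<one>, za, zb, z}"

lemma z_closed [simp]: "za \<in> carrier G" "zb \<in> carrier G" "z \<in> carrier G"
  by (simp_all add: za_def zb_def z_def)

lemma m_pos: "m > 0" by (simp add: m_eq)

lemma swap_z [simp]: "\<alpha> za = zb" "\<alpha> zb = za"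
  by (simp_all add: za_def zb_def swap.hom_nat_pow)

text \<open>The counting argument makes \<open>za\<close> commute with \<open>b\<close>; applying
  \<alpha> makes \<open>zb\<close> commute with \<open>a\<close>, without a second count.\<close>

lemma za_comm: "y \<in> carrier G \<Longrightarrow> za \<otimes> y = y \<otimes> za"
  and zb_comm: "y \<in> carrier G \<Longrightarrow> zb \<otimes> y = y \<otimes> zb"
proof -
  have b: "b \<otimes> za = za \<otimes> b"
    using half_pow_commute[of f] n_eq by (simp add: za_def m_eq[symmetric])
  then have a: "a \<otimes> zb = zb \<otimes> a"
    using swap.hom_mult[of b za] swap.hom_mult[of za b] by simp
  have "a \<otimes> za = za \<otimes> a" "b \<otimes> zb = zb \<otimes> b"
    by (simp_all add: za_def zb_def commute_pow_right)
  with a b show "za \<otimes> y = y \<otimes> za" "zb \<otimes> y = y \<otimes> zb" if "y \<in> carrier G"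
    using central_mono[OF _ _ _ that] by simp_all
qed

lemma z_comm: "y \<in> carrier G \<Longrightarrow> z \<otimes> y = y \<otimes> z"
  by (metis m_assoc z_def za_comm zb_comm z_closed)

lemma z_sq: "za \<otimes> za = \<one>" "zb \<otimes> zb = \<one>" "z \<otimes> z = \<one>"
proof -
  show *: "za \<otimes> za = \<one>" "zb \<otimes> zb = \<one>"
    by (simp_all add: za_def zb_def nat_pow_mult a_pow_eq_one_iff b_pow_eq_one_iff n_eq mult_2)
  have "z \<otimes> z = (za \<otimes> zb) \<otimes> (zb \<otimes> za)"
    using za_comm[of zb] by (simp add: z_def)
  also have "\<dots> = za \<otimes> (zb \<otimes> zb) \<otimes> za" by (simp add: m_assoc)
  finally show "z \<otimes> z = \<one>" using * by simp
qed

lemma z_ne: "za \<noteq> \<one>" "zb \<noteq> \<one>" "za \<noteq> zb" "z \<noteq> \<one>" "z \<noteq> za" "z \<noteq> zb"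
proof -
  have "\<not> n dvd m" using m_pos by (auto simp: n_eq dest: dvd_imp_le)
  then show *: "za \<noteq> \<one>" "zb \<noteq> \<one>"
    by (simp_all add: za_def zb_def a_pow_eq_one_iff b_pow_eq_one_iff)
  then show "za \<noteq> zb" "z \<noteq> \<one>"
    using pow_eq_imp_one[of m m] factorization_unique[of m m] by (auto simp: za_def zb_def z_def)
  show "z \<noteq> za" "z \<noteq> zb" using * by (simp_all add: z_def r_cancel_one l_cancel_one)
qed

lemma z_mult: "za \<otimes> zb = z" "zb \<otimes> za = z" "za \<otimes> z = zb" "z \<otimes> za = zb" "zb \<otimes> z = za" "z \<otimes> zb = za"
proof -
  show "za \<otimes> zb = z" by (simp add: z_def)
  show *: "zb \<otimes> za = z" using za_comm[of zb] by (simp add: z_def)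
  show 1: "za \<otimes> z = zb" by (simp add: z_def z_sq flip: m_assoc)
  show 2: "zb \<otimes> z = za" by (simp add: z_sq flip: * m_assoc)
  show "z \<otimes> za = zb" "z \<otimes> zb = za" using 1 2 z_comm by simp_all
qed

lemma swap_z_self [simp]: "\<alpha> z = z" unfolding z_def using za_comm[of zb] by simp

lemma N_closed [simp]: "w \<in> N \<Longrightarrow> w \<in> carrier G"
  by (auto simp: N_def)

lemma N_comm: "w \<in> N \<Longrightarrow> y \<in> carrier G \<Longrightarrow> w \<otimes> y = y \<otimes> w"
  by (auto simp: N_def za_comm zb_comm z_comm)

lemma N_sq: "w \<in> N \<Longrightarrow> w \<otimes> w = \<one>"
  by (auto simp: N_def z_sq)

lemma N_inv: "w \<in> N \<Longrightarrow> inv w = w"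
  using N_sq inv_equality by simp

lemma N_mem [simp]: "\<one> \<in> N" "za \<in> N" "zb \<in> N" "z \<in> N"
  by (simp_all add: N_def)

lemma N_mult [simp]: "v \<in> N \<Longrightarrow> w \<in> N \<Longrightarrow> v \<otimes> w \<in> N"
  unfolding N_def by (elim insertE emptyE; simp add: z_mult z_sq)

lemma N_pow [simp]: "w \<in> N \<Longrightarrow> w [^] (k::nat) \<in> N"
  by (induction k) simp_all

lemma N_pow_even: "w \<in> N \<Longrightarrow> even k \<Longrightarrow> w [^] (k::nat) = \<one>"
proof (elim evenE)
  fix j assume w: "w \<in> N" and k: "k = 2 * j"
  have "w [^] (2::nat) = \<one>" using w by (simp add: N_sq numeral_2_eq_2)
  then show "w [^] k = \<one>" unfolding k using w by (simp only: nat_pow_pow[symmetric] N_closed nat_pow_one)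
qed

lemma N_swap [simp]: "w \<in> N \<Longrightarrow> \<alpha> w \<in> N"
  by (auto simp: N_def)

text \<open>Every error term of the lifting is confined to powers of \<open>z\<close> through this
  fact.\<close>

lemma N_swap_fixed: "w \<in> N \<Longrightarrow> \<alpha> w = w \<Longrightarrow> w = \<one> \<or> w = z"
  using z_ne by (auto simp: N_def)

text \<open>Such a product is a norm, hence fixed by \<alpha>. In particular it is never
  \<open>zb\<close>, which later excludes \<open>k = 1\<close>.\<close>

lemma N_mult_swap: "w \<in> N \<Longrightarrow> w \<otimes> \<alpha> w = \<one> \<or> w \<otimes> \<alpha> w = z"
  by (auto simp: N_def z_mult z_sq)

lemma N_left_comm: "w \<in> N \<Longrightarrow> x \<in> carrier G \<Longrightarrow> y \<in> carrier G \<Longrightarrow> x \<otimes> (w \<otimes> y) = w \<otimes> (x \<otimes> y)"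
  using N_comm[of w x] by (metis N_closed m_assoc)

lemma normal_N: "N \<lhd> G"
proof (rule normal_invI)
  show "subgroup N G"
  proof (rule subgroupI)
    show "N \<subseteq> carrier G" by (simp add: subset_iff)
    show "N \<noteq> {}" using N_mem by blast
  qed (simp_all add: N_inv)
  show "x \<otimes> h \<otimes> inv x \<in> N" if "x \<in> carrier G" "h \<in> N" for x h
  proof -
    have "x \<otimes> h \<otimes> inv x = h \<otimes> x \<otimes> inv x"
      using that N_comm[OF that(2,1)] by simp
    also have "\<dots> = h" using that by (simp add: m_assoc)
    finally show ?thesis using that by simp
  qed
qed

lemma pow_add_m: "a [^] (i + m) = a [^] i \<otimes> za" "b [^] (i + m) = b [^] i \<otimes> zb"
  by (simp_all add: za_def zb_def nat_pow_mult)

text \<open>Factors of \<open>N\<close> are absorbed by shifting exponents by \<open>m\<close>: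
  \<open>zb\<close> into the power of \<open>b\<close>, \<open>za\<close> into that of
  \<open>a\<close>. What remains is an equation between powers in \<open>G\<close>. This gives both
  the orders and the trivial intersection in the quotient.\<close>

lemma a_pow_eq_b_pow_mod_N:
  assumes "a [^] (i::nat) = b [^] (j::nat) \<otimes> w" "w \<in> N"
  shows "m dvd i"
proof -
  have dvd: "m dvd i'" if "a [^] i' = b [^] j'" for i' j' :: nat
  proof -
    have "n dvd i'" using pow_eq_imp_one[OF that] by (simp add: a_pow_eq_one_iff)
    then show ?thesis by (simp add: n_eq dvd_mult_right)
  qed
  have dvd_za: "m dvd i" if "a [^] i = b [^] j' \<otimes> za" for j' :: nat
    using dvd[of "i + m" j'] that by (simp add: pow_add_m m_assoc z_sq)
  consider "w = \<one>" | "w = za" | "w = zb" | "w = z" using assms(2) by (auto simp: N_def)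
  then show ?thesis
  proof cases
    case 1
    then show ?thesis using assms dvd by simp
  next
    case 2
    then show ?thesis using assms dvd_za by simp
  next
    case 3
    then show ?thesis using assms dvd[of i "j + m"]
      by (simp add: pow_add_m)
  next
    case 4
    then show ?thesis using assms dvd_za[of "j + m"]
      by (simp add: pow_add_m m_assoc z_mult)
  qed
qed

lemma a_pow_mem_N: "a [^] (i::nat) \<in> N \<longleftrightarrow> m dvd i"
proof
  assume "a [^] i \<in> N"
  then show "m dvd i" using a_pow_eq_b_pow_mod_N[of i 0 "a [^] i"] by simp
next
  assume "m dvd i"
  then obtain k where "i = m * k" ..
  then have "a [^] i = za [^] k" by (simp add: za_def nat_pow_pow)
  then show "a [^] i \<in> N" by simp
qed

lemma b_pow_mem_N: "b [^] (i::nat) \<in> N \<longleftrightarrow> m dvd i"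
proof -
  have "\<alpha> (b [^] i) = a [^] i" "\<alpha> (a [^] i) = b [^] i" by (simp_all add: swap.hom_nat_pow)
  then show ?thesis using N_swap a_pow_mem_N by metis
qed

text \<open>The elements of \<open>H\<close> are representatives lying in \<open>G\<close>, so
  \<phi> after \<alpha> can serve as its swap; it respects products because \<alpha> preserves
  \<open>N\<close>. The last conclusion is the tool for lifting identities: equal images differ by a
  factor in \<open>N\<close>.\<close>

lemma quotient:
  obtains H :: "('a, 'b) monoid_scheme" and \<phi> \<alpha>' where
    "isobicyclic H m (\<phi> a) (\<phi> b) \<alpha>'" "group_hom G H \<phi>"
    "\<And>x y. x \<in> carrier G \<Longrightarrow> y \<in> carrier G \<Longrightarrow> \<phi> x = \<phi> y \<Longrightarrow> \<exists>w\<in>N. x = y \<otimes> w"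
proof -
  interpret N: normal N G by (rule normal_N)
  obtain H :: "('a, 'b) monoid_scheme" and \<phi> where H: "group H" "\<phi> \<in> hom G H"
    "carrier H = \<phi> ` carrier G" "carrier H \<subseteq> carrier G"
    and eq: "\<And>x y. x \<in> carrier G \<Longrightarrow> y \<in> carrier G \<Longrightarrow> \<phi> x = \<phi> y \<longleftrightarrow> N #> x = N #> y"
    and idem: "\<And>x. x \<in> carrier G \<Longrightarrow> \<phi> (\<phi> x) = \<phi> x"
    using quotient_on_representatives[OF normal_N] by metis
  interpret H: group_hom G H \<phi>
    using H by (simp add: group_hom_def group_hom_axioms_def is_group)
  have eqD: "\<exists>w\<in>N. x = y \<otimes> w" if "x \<in> carrier G" "y \<in> carrier G" "\<phi> x = \<phi> y" for x y
  proof -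
    have "x \<in> N #> y" using that eq rcos_self[OF that(1) N.is_subgroup] by simp
    then obtain w where "w \<in> N" "x = w \<otimes> y" by (auto simp: r_coset_def)
    then show ?thesis using N_comm[OF _ that(2)] by blast
  qed
  have eq1: "\<phi> w = \<one>\<^bsub>H\<^esub> \<longleftrightarrow> w \<in> N" if "w \<in> carrier G" for w
  proof
    assume "\<phi> w = \<one>\<^bsub>H\<^esub>"
    then have "\<phi> w = \<phi> \<one>" by simp
    from eqD[OF that one_closed this] show "w \<in> N" by auto
  next
    assume "w \<in> N"
    then have "N #> w = N #> \<one>" by (simp add: N.rcos_const N.subset)
    then have "\<phi> w = \<phi> \<one>" using eq that by blast
    then show "\<phi> w = \<one>\<^bsub>H\<^esub>" by simp
  qed
  have sub: "x \<in> carrier G" if "x \<in> carrier H" for x using that H by blast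
  have \<phi>\<alpha>\<phi>: "\<phi> (\<alpha> (\<phi> x)) = \<phi> (\<alpha> x)" if x: "x \<in> carrier G" for x
  proof -
    have "\<phi> x \<in> carrier G" using x by (simp add: sub)
    then obtain w where "w \<in> N" "\<phi> x = x \<otimes> w" using eqD[of "\<phi> x" x] idem x by auto
    then show ?thesis using x by (simp add: eq1)
  qed
  have "isobicyclic H m (\<phi> a) (\<phi> b) (\<phi> \<circ> \<alpha>)"
  proof (unfold_locales, goal_cases)
    case (3 i) then show ?case by (simp add: eq1 a_pow_mem_N flip: H.hom_nat_pow)
  next
    case (4 i) then show ?case by (simp add: eq1 b_pow_mem_N flip: H.hom_nat_pow)
  next
    case (5 x)
    then obtain y where y: "y \<in> carrier G" "x = \<phi> y" using H by auto
    then obtain i j :: nat where "y = a [^] i \<otimes> b [^] j" using factorization by blast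
    then have "x = \<phi> a [^]\<^bsub>H\<^esub> i \<otimes>\<^bsub>H\<^esub> \<phi> b [^]\<^bsub>H\<^esub> j"
      using y by (simp add: H.hom_nat_pow)
    then show ?case by blast
  next
    case (6 i j)
    then have "\<phi> (a [^] i) = \<phi> (b [^] j)" by (simp add: H.hom_nat_pow)
    then obtain w where "w \<in> N" "a [^] i = b [^] j \<otimes> w"
      using eqD[of "a [^] i" "b [^] j"] by auto
    then have "a [^] i \<in> N" using a_pow_eq_b_pow_mod_N a_pow_mem_N by blast
    then have "\<phi> (a [^] i) = \<one>\<^bsub>H\<^esub>" by (simp only: eq1 nat_pow_closed a_closed)
    then show ?case by (simp add: H.hom_nat_pow)
  next
    case 8
    show ?case
    proof (rule homI)
      fix x y assume xy: "x \<in> carrier H" "y \<in> carrier H"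
      then obtain x' y' where x': "x' \<in> carrier G" "x = \<phi> x'" and y': "y' \<in> carrier G" "y = \<phi> y'"
        using H by auto
      have "x \<otimes>\<^bsub>H\<^esub> y = \<phi> (x' \<otimes> y')" using x' y' by simp
      then show "(\<phi> \<circ> \<alpha>) (x \<otimes>\<^bsub>H\<^esub> y) = (\<phi> \<circ> \<alpha>) x \<otimes>\<^bsub>H\<^esub> (\<phi> \<circ> \<alpha>) y"
        using x' y' by (simp add: \<phi>\<alpha>\<phi> del: H.hom_mult)
           (simp add: swap.hom_mult)
    qed (simp add: sub)
  qed (simp_all add: m_pos \<phi>\<alpha>\<phi>)
  then show thesis using that eqD H.group_hom_axioms by blast
qed

end


section \<open>The dichotomy\<close>

text \<open>The second conjunct puts \<open>z\<close> into \<open>\<langle>h\<rangle>\<close>, \<open>h = a\<^sup>-\<^sup>1 b\<close>; without it normality of \<open>\<langle>h\<rangle>\<close> would not lift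
  from the quotient.\<close>

definition cyclic_type :: "('a, 'm) monoid_scheme \<Rightarrow> nat \<Rightarrow> 'a \<Rightarrow> 'a \<Rightarrow> bool" where
  "cyclic_type G n a b \<longleftrightarrow>
     (\<exists>r::nat. grp_conj G (inv\<^bsub>G\<^esub> a \<otimes>\<^bsub>G\<^esub> b) a = (inv\<^bsub>G\<^esub> a \<otimes>\<^bsub>G\<^esub> b) [^]\<^bsub>G\<^esub> r) \<and>
     (inv\<^bsub>G\<^esub> a \<otimes>\<^bsub>G\<^esub> b) [^]\<^bsub>G\<^esub> (n div 2) = a [^]\<^bsub>G\<^esub> (n div 2) \<otimes>\<^bsub>G\<^esub> b [^]\<^bsub>G\<^esub> (n div 2)"

text \<open>The relations of \<open>G2_rels\<close> evaluated in an arbitrary group, so that one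
  predicate serves for \<open>G\<close>, its quotients and the presented group.\<close>

definition G2_type :: "('a, 'm) monoid_scheme \<Rightarrow> nat \<Rightarrow> nat \<Rightarrow> nat \<Rightarrow> 'a \<Rightarrow> 'a \<Rightarrow> bool" where
  "G2_type G n k l a b \<longleftrightarrow>
     (let z = a [^]\<^bsub>G\<^esub> (n div 2) \<otimes>\<^bsub>G\<^esub> b [^]\<^bsub>G\<^esub> (n div 2)
      in a [^]\<^bsub>G\<^esub> n = \<one>\<^bsub>G\<^esub> \<and> b [^]\<^bsub>G\<^esub> n = \<one>\<^bsub>G\<^esub> \<and>
        grp_comm G (b [^]\<^bsub>G\<^esub> (2::nat)) (a [^]\<^bsub>G\<^esub> (2::nat)) = \<one>\<^bsub>G\<^esub> \<and>
        grp_comm G b a = a [^]\<^bsub>G\<^esub> (2::nat) \<otimes>\<^bsub>G\<^esub> b [^]\<^bsub>G\<^esub> (-2::int) \<otimes>\<^bsub>G\<^esub> z [^]\<^bsub>G\<^esub> k \<and>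
        grp_conj G (b [^]\<^bsub>G\<^esub> (2::nat)) a = b [^]\<^bsub>G\<^esub> (-2::int) \<otimes>\<^bsub>G\<^esub> z [^]\<^bsub>G\<^esub> l \<and>
        grp_conj G (a [^]\<^bsub>G\<^esub> (2::nat)) b = a [^]\<^bsub>G\<^esub> (-2::int) \<otimes>\<^bsub>G\<^esub> z [^]\<^bsub>G\<^esub> l)"

lemma (in group) int_pow_minus_two: "x \<in> carrier G \<Longrightarrow> x [^] (-2::int) = inv (x [^] (2::nat))"
  using int_pow_neg_int[of x 2] by simp

lemma (in group) grp_comm_closed [simp]:
  "x \<in> carrier G \<Longrightarrow> y \<in> carrier G \<Longrightarrow> grp_comm G x y \<in> carrier G"
  by (simp add: grp_comm_def)

lemma (in group) grp_comm_eq_one_iff: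
  "x \<in> carrier G \<Longrightarrow> y \<in> carrier G \<Longrightarrow> grp_comm G x y = \<one> \<longleftrightarrow> grp_conj G x y = x"
proof -
  assume xy: "x \<in> carrier G" "y \<in> carrier G"
  then have "grp_comm G x y = inv x \<otimes> grp_conj G x y"
    by (simp add: grp_comm_def grp_conj_def m_assoc)
  then show ?thesis using xy by (metis grp_conj_closed inv_closed inv_equality inv_inv l_inv)
qed

lemma (in group) grp_conj_eq_mult_comm:
  "x \<in> carrier G \<Longrightarrow> y \<in> carrier G \<Longrightarrow> grp_conj G x y = x \<otimes> grp_comm G x y"
  by (simp add: grp_comm_def grp_conj_def word_simps)

lemma (in group_hom) hom_grp_conj:
  "x \<in> carrier G \<Longrightarrow> y \<in> carrier G \<Longrightarrow> h (grp_conj G x y) = grp_conj H (h x) (h y)"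
  by (simp add: grp_conj_def)

lemma (in group_hom) hom_grp_comm:
  "x \<in> carrier G \<Longrightarrow> y \<in> carrier G \<Longrightarrow> h (grp_comm G x y) = grp_comm H (h x) (h y)"
  by (simp add: grp_comm_def)

context isobicyclic_half begin

lemma conj_N [simp]: "w \<in> N \<Longrightarrow> g \<in> carrier G \<Longrightarrow> grp_conj G w g = w"
  by (simp add: grp_conj_eq_self N_comm)

text \<open>The factor \<open>w\<close> is central, so it merely accumulates. For even
  \<open>k\<close> it disappears, which is how squares come to commute with elements that are
  central modulo \<open>N\<close>.\<close>

lemma conj_pow_of_conj:
  assumes "x \<in> carrier G" "g \<in> carrier G" "w \<in> N" "grp_conj G x g = x \<otimes> w"
  shows "grp_conj G x (g [^] (k::nat)) = x \<otimes> w [^] k"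
proof (induction k)
  case 0
  show ?case using assms by (simp add: grp_conj_def)
next
  case (Suc k)
  have "grp_conj G x (g [^] Suc k) = grp_conj G (grp_conj G x (g [^] k)) g"
    using assms by (simp add: grp_conj_conj)
  also have "\<dots> = x \<otimes> w \<otimes> w [^] k" using assms by (simp add: Suc grp_conj_mult)
  also have "\<dots> = x \<otimes> w [^] Suc k" using assms N_comm[of w "w [^] k"] by (simp add: m_assoc)
  finally show ?case .
qed

lemma pow_mult_N:
  assumes "x \<in> carrier G" "w \<in> N"
  shows "(x \<otimes> w) [^] (k::nat) = x [^] k \<otimes> w [^] k"
  using assms N_comm[of w x] by (intro pow_mult_distrib) simp_all

end

section \<open>Quarter powers, and the case \<open>n = 4\<close>\<close>

locale isobicyclic_quarter = isobicyclic_half +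
  fixes g q :: nat
  assumes m_eq_double: "m = 2 * q" and q_eq: "q = 2 ^ g"
begin

lemma quarter_quotient:
  obtains H :: "('a, 'b) monoid_scheme" and \<phi> \<alpha>' where
    "isobicyclic_half H m (\<phi> a) (\<phi> b) \<alpha>' g q" "group_hom G H \<phi>"
    "\<And>x y. x \<in> carrier G \<Longrightarrow> y \<in> carrier G \<Longrightarrow> \<phi> x = \<phi> y \<Longrightarrow> \<exists>w\<in>N. x = y \<otimes> w"
proof (rule quotient)
  fix H :: "('a, 'b) monoid_scheme" and \<phi> \<alpha>'
  assume "isobicyclic H m (\<phi> a) (\<phi> b) \<alpha>'" and H: "group_hom G H \<phi>"
    and eqD: "\<And>x y. x \<in> carrier G \<Longrightarrow> y \<in> carrier G \<Longrightarrow> \<phi> x = \<phi> y \<Longrightarrow> \<exists>w\<in>N. x = y \<otimes> w"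
  then have "isobicyclic_half H m (\<phi> a) (\<phi> b) \<alpha>' g q"
    by (intro isobicyclic_half.intro isobicyclic_half_axioms.intro m_eq_double q_eq)
  then show thesis using H eqD by (rule that)
qed

text \<open>In the quotient, of order parameter \<open>n/2\<close>, the powers with exponent
  \<open>q\<close> are the half powers and hence central.\<close>

lemma quarter_conj:
  assumes "y \<in> carrier G"
  shows "\<exists>w\<in>N. grp_conj G (a [^] q) y = a [^] q \<otimes> w"
    and "\<exists>w\<in>N. grp_conj G (b [^] q) y = b [^] q \<otimes> w"
proof -
  obtain H :: "('a, 'b) monoid_scheme" and \<phi> \<alpha>' where
    H: "isobicyclic_half H m (\<phi> a) (\<phi> b) \<alpha>' g q" "group_hom G H \<phi>"
    and eqD: "\<And>x y. x \<in> carrier G \<Longrightarrow> y \<in> carrier G \<Longrightarrow> \<phi> x = \<phi> y \<Longrightarrow> \<exists>w\<in>N. x = y \<otimes> w"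
    by (rule quarter_quotient) (rule that; assumption)
  interpret H: isobicyclic_half H m "\<phi> a" "\<phi> b" \<alpha>' g q by (rule H)
  interpret \<phi>: group_hom G H \<phi> by (rule H)
  have "\<phi> (grp_conj G (a [^] q) y) = \<phi> (a [^] q)" "\<phi> (grp_conj G (b [^] q) y) = \<phi> (b [^] q)"
    using assms H.za_comm[of "\<phi> y"] H.zb_comm[of "\<phi> y"]
    by (simp_all add: \<phi>.hom_grp_conj \<phi>.hom_nat_pow H.za_def H.zb_def H.grp_conj_eq_self)
  then show "\<exists>w\<in>N. grp_conj G (a [^] q) y = a [^] q \<otimes> w"
    "\<exists>w\<in>N. grp_conj G (b [^] q) y = b [^] q \<otimes> w"
    using eqD assms by simp_all
qed

text \<open>Here the quarter powers are \<open>a\<close> and \<open>b\<close> themselves, so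
  \<open>b a = a b w\<close> with \<open>w\<close> in \<open>N\<close>. Applying \<alpha> gives
  \<open>w \<alpha>(w) = 1\<close>, hence \<open>w\<close> is 1 or \<open>z\<close>: the group is
  abelian or the commutator is \<open>z = a^2 b^2\<close>.\<close>

lemma type_four:
  assumes "q = 1"
  shows "cyclic_type G n a b \<or> G2_type G n 0 0 a b"
proof -
  have m: "m = 2" "n = 4" using assms by (simp_all add: m_eq_double n_eq)
  have sq: "a [^] (2::nat) = za" "b [^] (2::nat) = zb" by (simp_all add: za_def zb_def flip: m)
  obtain w where w: "w \<in> N" "grp_conj G b a = b \<otimes> w"
    using quarter_conj(2)[of a] assms by auto
  then have ba: "b \<otimes> a = a \<otimes> b \<otimes> w" by (simp add: grp_conj_eq_iff m_assoc)
  have "\<alpha> (b \<otimes> a) = \<alpha> (a \<otimes> b \<otimes> w)" by (simp only: ba)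
  then have "a \<otimes> b = b \<otimes> a \<otimes> \<alpha> w" using w by simp
  then have "a \<otimes> b = a \<otimes> b \<otimes> (w \<otimes> \<alpha> w)" using w by (simp add: ba m_assoc)
  then have "w \<otimes> \<alpha> w = \<one>" using w by (metis N_closed N_swap a_closed b_closed l_cancel_one m_closed)
  then have "\<alpha> w = w" using w by (metis N_closed N_inv N_swap inv_equality inv_inv)
  then consider "w = \<one>" | "w = z" using w N_swap_fixed by blast
  then show ?thesis
  proof cases
    case 1
    then have comm: "b \<otimes> a = a \<otimes> b" using ba by simp
    have "inv a \<otimes> b = b \<otimes> inv a"
      using comm by (metis a_closed b_closed inv_closed inv_solve_left m_assoc m_closed inv_solve_right)
    moreover have "grp_conj G (inv a \<otimes> b) a = inv a \<otimes> b"
      using comm by (simp add: grp_conj_eq_iff word_simps)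
    ultimately have "cyclic_type G n a b"
      unfolding cyclic_type_def m(2)
      by (auto simp: pow_mult_distrib nat_pow_inv sq N_inv z_mult intro!: exI[of _ "1::nat"])
    then show ?thesis ..
  next
    case 2
    have "b \<otimes> grp_comm G b a = b \<otimes> z"
      using w 2 by (simp flip: grp_conj_eq_mult_comm)
    then have "grp_comm G b a = z" by simp
    then have "G2_type G n 0 0 a b"
      unfolding G2_type_def m(2)
      by (simp add: Let_def int_pow_minus_two sq a_pow_eq_one_iff b_pow_eq_one_iff m(2)
          grp_comm_eq_one_iff N_inv z_mult)
    then show ?thesis ..
  qed
qed

end

section \<open>The square root \<open>c\<close> of \<open>z\<close>, and lifting the cyclic
  type\<close>

locale isobicyclic_eighth = isobicyclic_quarter +
  assumes q_even: "even q"
begin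

definition "c = a [^] q \<otimes> b [^] q"

lemma c_closed [simp]: "c \<in> carrier G" by (simp add: c_def)

text \<open>Conjugation by \<open>a\<close> changes \<open>b^q\<close> by a factor in
  \<open>N\<close>; conjugation by \<open>a^q\<close> changes it by the \<open>q\<close>-th power of
  that factor, which is 1 as \<open>q\<close> is even.\<close>

lemma quarter_comm: "b [^] q \<otimes> a [^] q = a [^] q \<otimes> b [^] q"
proof -
  obtain w where "w \<in> N" "grp_conj G (b [^] q) a = b [^] q \<otimes> w"
    using quarter_conj(2)[of a] by auto
  then have "grp_conj G (b [^] q) (a [^] q) = b [^] q"
    by (simp add: conj_pow_of_conj q_even N_pow_even)
  then show ?thesis by (simp add: grp_conj_eq_iff)
qed

lemma swap_c [simp]: "\<alpha> c = c" by (simp add: c_def swap.hom_nat_pow quarter_comm)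

lemma c_sq: "c \<otimes> c = z"
proof -
  have "c \<otimes> c = a [^] q \<otimes> (b [^] q \<otimes> a [^] q) \<otimes> b [^] q" by (simp add: c_def m_assoc)
  also have "\<dots> = (a [^] q \<otimes> a [^] q) \<otimes> (b [^] q \<otimes> b [^] q)" by (simp add: quarter_comm m_assoc)
  also have "\<dots> = z" by (simp add: nat_pow_mult z_def za_def zb_def flip: mult_2 m_eq_double)
  finally show ?thesis .
qed

lemma c_conj: "y \<in> carrier G \<Longrightarrow> \<exists>w\<in>N. grp_conj G c y = c \<otimes> w"
proof -
  assume y: "y \<in> carrier G"
  then obtain v w where v: "v \<in> N" "grp_conj G (a [^] q) y = a [^] q \<otimes> v"
    and w: "w \<in> N" "grp_conj G (b [^] q) y = b [^] q \<otimes> w"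
    using quarter_conj[OF y] by auto
  have "grp_conj G c y = a [^] q \<otimes> (v \<otimes> b [^] q) \<otimes> w"
    using v w y by (simp add: c_def grp_conj_mult m_assoc)
  also have "\<dots> = c \<otimes> (v \<otimes> w)"
    using v w y N_comm[of v "b [^] q"] by (simp add: c_def m_assoc)
  finally show ?thesis using v w by (intro bexI[of _ "v \<otimes> w"]) simp_all
qed

lemma c_conj_sq: "y \<in> carrier G \<Longrightarrow> grp_conj G c (y [^] (2::nat)) = c"
proof -
  assume y: "y \<in> carrier G"
  then obtain w where "w \<in> N" "grp_conj G c y = c \<otimes> w" using c_conj[OF y] by auto
  then show ?thesis using y by (simp add: conj_pow_of_conj N_pow_even)
qed

text \<open>Lifting costs a factor \<open>w\<close> in \<open>N\<close>, which could leave the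
  powers of \<open>h\<close>. The swap forces \<open>w\<close> to be 1 or \<open>z\<close>, and
  \<open>z\<close> is the power \<open>h^m\<close>.\<close>

lemma cyclic_type_step:
  assumes H: "group_hom G H \<phi>" and eqD: "\<And>x y. x \<in> carrier G \<Longrightarrow> y \<in> carrier G \<Longrightarrow> \<phi> x = \<phi> y \<Longrightarrow> \<exists>w\<in>N. x = y \<otimes> w"
    and cyc: "cyclic_type H m (\<phi> a) (\<phi> b)"
  shows "cyclic_type G n a b"
proof -
  interpret \<phi>: group_hom G H \<phi> by (rule H)
  define h where "h = inv a \<otimes> b"
  have h [simp]: "h \<in> carrier G" by (simp add: h_def)
  have \<phi>h: "inv\<^bsub>H\<^esub> \<phi> a \<otimes>\<^bsub>H\<^esub> \<phi> b = \<phi> h" by (simp add: h_def)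
  obtain r :: nat where "grp_conj H (\<phi> h) (\<phi> a) = \<phi> h [^]\<^bsub>H\<^esub> r"
    and hq: "\<phi> h [^]\<^bsub>H\<^esub> q = \<phi> a [^]\<^bsub>H\<^esub> q \<otimes>\<^bsub>H\<^esub> \<phi> b [^]\<^bsub>H\<^esub> q"
    using cyc unfolding cyclic_type_def \<phi>h by (auto simp: m_eq_double)
  then have "\<phi> (grp_conj G h a) = \<phi> (h [^] r)" by (simp add: \<phi>.hom_grp_conj \<phi>.hom_nat_pow)
  then obtain w where w: "w \<in> N" "grp_conj G h a = h [^] r \<otimes> w"
    using eqD[of "grp_conj G h a" "h [^] r"] by auto
  have "\<phi> (h [^] q) = \<phi> c" using hq by (simp add: c_def \<phi>.hom_nat_pow)
  then obtain v where v: "v \<in> N" "h [^] q = c \<otimes> v" using eqD[of "h [^] q" c] by auto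
  \<comment> \<open>Squaring \<open>c v\<close> removes the unknown central factor \<open>v\<close>,
    whose square is 1.\<close>
  have "h [^] m = h [^] q \<otimes> h [^] q" by (simp add: m_eq_double mult_2 nat_pow_mult)
  also have "\<dots> = c \<otimes> (v \<otimes> c) \<otimes> v" using v by (simp add: m_assoc)
  also have "\<dots> = c \<otimes> c \<otimes> (v \<otimes> v)" using v N_comm[of v c] by (simp add: m_assoc)
  also have "\<dots> = z" using v by (simp add: N_sq c_sq)
  finally have hm: "h [^] m = z" .
  have \<alpha>h: "\<alpha> h = inv h" by (simp add: h_def inv_mult_group)
  have "grp_conj G (inv h) b = \<alpha> (grp_conj G h a)" by (simp add: swap.hom_grp_conj \<alpha>h)
  also have "\<dots> = inv (h [^] r) \<otimes> \<alpha> w"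
    using w by (simp add: swap.hom_nat_pow \<alpha>h nat_pow_inv)
  finally have "grp_conj G (inv h) b = inv (h [^] r) \<otimes> \<alpha> w" .
  then have "inv (grp_conj G h b) = inv (h [^] r) \<otimes> \<alpha> w" by (simp add: grp_conj_inv)
  then have "grp_conj G h b = inv (inv (h [^] r) \<otimes> \<alpha> w)" using w by (metis b_closed grp_conj_closed h inv_inv)
  also have "\<dots> = h [^] r \<otimes> \<alpha> w"
    using w N_comm[of "\<alpha> w" "h [^] r"] by (simp add: inv_mult_group N_inv)
  finally have 1: "grp_conj G h b = h [^] r \<otimes> \<alpha> w" .
  \<comment> \<open>Second evaluation of the conjugate by \<open>b\<close>: conjugating by
    \<open>a\<close> lands in the powers of \<open>h\<close> times \<open>N\<close>, on which
    \<open>h\<close> acts trivially. Comparison with the value obtained from \<alpha> gives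
    \<alpha>(w) = w.\<close>
  have "b = a \<otimes> h" by (simp add: h_def word_simps)
  then have "grp_conj G h b = grp_conj G (grp_conj G h a) h" by (simp add: grp_conj_conj)
  also have "\<dots> = h [^] r \<otimes> w"
    using w by (simp add: grp_conj_mult grp_conj_pow grp_conj_eq_self)
  finally have "\<alpha> w = w" using 1 w by simp
  then consider "w = \<one>" | "w = z" using w N_swap_fixed by blast
  then have "\<exists>r::nat. grp_conj G h a = h [^] r"
  proof cases
    case 2
    then have "grp_conj G h a = h [^] (r + m)" using w hm by (simp flip: nat_pow_mult)
    then show ?thesis ..
  qed (use w in auto)
  then show ?thesis using hm by (simp add: cyclic_type_def n_eq z_def za_def zb_def flip: h_def)
qed

end


section \<open>Lifting the relations of \<open>G2_type\<close>\<close>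

context isobicyclic_eighth begin

lemma c_pow_conj_sq: "y \<in> carrier G \<Longrightarrow> grp_conj G (c [^] (k::nat)) (y [^] (2::nat)) = c [^] k"
  by (simp add: grp_conj_pow c_conj_sq)

lemma c_pow_comm_sq:
  "y \<in> carrier G \<Longrightarrow> c [^] (k::nat) \<otimes> y [^] (2::nat) = y [^] (2::nat) \<otimes> c [^] k"
  using c_pow_conj_sq[of y k] by (simp add: grp_conj_eq_iff)

lemma c_pow_sq: "c [^] (k::nat) \<otimes> c [^] k = z [^] k"
  by (simp add: c_sq flip: pow_mult_distrib)

text \<open>\<open>c = a\<^bsup>n/4\<^esup> b\<^bsup>n/4\<^esup>\<close> represents the element \<open>z\<close> of the quotient. If \<open>l = 1\<close>, then
  \<open>[b\<^sup>2, a\<^sup>2] = [c, a]\<close> is one of the two generators of \<open>N\<close>, yet it is fixed by \<open>\<alpha>\<close>. If \<open>k = 1\<close>,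
  squaring \<open>b\<^sup>a\<close> gives \<open>w2 \<alpha>(w2) = b\<^bsup>n/2\<^esup>\<close>, again not fixed by \<open>\<alpha>\<close>.\<close>

lemma G2_type_step:
  assumes H: "group_hom G H \<phi>"
    and eqD: "\<And>x y. x \<in> carrier G \<Longrightarrow> y \<in> carrier G \<Longrightarrow> \<phi> x = \<phi> y \<Longrightarrow> \<exists>w\<in>N. x = y \<otimes> w"
    and G2: "G2_type H m k l (\<phi> a) (\<phi> b)"
    and kl: "k \<le> 1" "l \<le> 1" "\<not> 4 dvd q \<Longrightarrow> k = 0 \<and> l = 0"
  shows "\<exists>k\<in>{0, 1}. \<exists>l\<in>{0, 1}. G2_type G n k l a b"
proof -
  interpret \<phi>: group_hom G H \<phi> by (rule H)
  \<comment> \<open>\<open>C\<close> and \<open>D\<close> lift the factors \<open>z^k\<close> and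
    \<open>z^l\<close> of the quotient; they are fixed by \<alpha> and commute with the squares
    \<open>A\<close> and \<open>B\<close>.\<close>
  define A B C D where "A = a [^] (2::nat)" and "B = b [^] (2::nat)"
    and "C = c [^] k" and "D = c [^] l"
  have [simp]: "A \<in> carrier G" "B \<in> carrier G" "C \<in> carrier G" "D \<in> carrier G"
    by (simp_all add: A_def B_def C_def D_def)
  have swapped [simp]: "\<alpha> A = B" "\<alpha> B = A" "\<alpha> C = C" "\<alpha> D = D"
    by (simp_all add: A_def B_def C_def D_def swap.hom_nat_pow)
  have CA: "C \<otimes> A = A \<otimes> C" "C \<otimes> B = B \<otimes> C" "D \<otimes> A = A \<otimes> D" "D \<otimes> B = B \<otimes> D"
    by (simp_all add: A_def B_def C_def D_def c_pow_comm_sq)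
  have CA': "C \<otimes> inv A = inv A \<otimes> C" "C \<otimes> inv B = inv B \<otimes> C" "D \<otimes> inv A = inv A \<otimes> D" "D \<otimes> inv B = inv B \<otimes> D"
    using CA by (metis \<open>A \<in> carrier G\<close> \<open>B \<in> carrier G\<close> \<open>C \<in> carrier G\<close> \<open>D \<in> carrier G\<close>
        grp_conj_eq_iff grp_conj_inv inv_closed)+
  have "\<phi> (grp_comm G b a) = \<phi> (A \<otimes> inv B \<otimes> C)"
    "\<phi> (grp_conj G B a) = \<phi> (inv B \<otimes> D)"
    using G2 unfolding G2_type_def Let_def
    by (simp_all add: \<phi>.hom_grp_comm \<phi>.hom_grp_conj \<phi>.hom_nat_pow \<phi>.int_pow_minus_two
        A_def B_def C_def D_def c_def m_eq_double)
  then obtain w1 w2 where w1: "w1 \<in> N" and comm: "grp_comm G b a = A \<otimes> inv B \<otimes> C \<otimes> w1"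
    and w2: "w2 \<in> N" and conj: "grp_conj G B a = inv B \<otimes> D \<otimes> w2"
    using eqD[of "grp_comm G b a" "A \<otimes> inv B \<otimes> C"] eqD[of "grp_conj G B a" "inv B \<otimes> D"] by auto
  \<comment> \<open>The relations with \<open>a\<close> and \<open>b\<close> exchanged are obtained
    through \<alpha>, not lifted separately, so their error terms are tied to \<open>w1\<close> and
    \<open>w2\<close>.\<close>
  have comm': "grp_comm G a b = B \<otimes> inv A \<otimes> C \<otimes> \<alpha> w1"
    using w1 swap.hom_grp_comm[of b a] by (simp add: comm)
  have conj': "grp_conj G A b = inv A \<otimes> D \<otimes> \<alpha> w2"
    using w2 swap.hom_grp_conj[of B a] by (simp add: conj)

  \<comment> \<open>The commutators of \<open>a, b\<close> and of \<open>b, a\<close> are mutually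
    inverse; multiplying them out leaves \<open>C^2 = z^k\<close> and the two error terms.\<close>
  have E1: "z [^] k \<otimes> (w1 \<otimes> \<alpha> w1) = \<one>"
  proof -
    have "\<one> = grp_comm G a b \<otimes> grp_comm G b a" by (simp add: grp_comm_def word_simps)
    also have "\<dots> = B \<otimes> inv A \<otimes> C \<otimes> (\<alpha> w1 \<otimes> (A \<otimes> inv B \<otimes> C)) \<otimes> w1"
      using w1 by (simp add: comm comm' m_assoc)
    also have "\<dots> = B \<otimes> inv A \<otimes> (C \<otimes> A) \<otimes> inv B \<otimes> C \<otimes> (\<alpha> w1 \<otimes> w1)"
      using w1 N_comm[of "\<alpha> w1" "A \<otimes> inv B \<otimes> C"] by (simp add: m_assoc)
    also have "\<dots> = B \<otimes> (C \<otimes> inv B) \<otimes> C \<otimes> (\<alpha> w1 \<otimes> w1)"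
      using w1 by (simp add: CA word_simps)
    also have "\<dots> = C \<otimes> C \<otimes> (\<alpha> w1 \<otimes> w1)"
      using w1 by (simp add: CA' word_simps)
    finally show ?thesis using w1 N_comm[of w1 "\<alpha> w1"] by (simp add: C_def c_pow_sq)
  qed

  obtain t where t: "t \<in> N" "grp_conj G c a = c \<otimes> t" using c_conj[of a] by auto
  have Da: "grp_conj G D a = D \<otimes> t [^] l" by (simp add: D_def grp_conj_pow t pow_mult_N)
  \<comment> \<open>Conjugating by \<open>a\<close> twice inverts \<open>B\<close> twice and cancels
    \<open>w2\<close>; only the failure of \<open>D\<close> to commute with \<open>a\<close>
    survives.\<close>
  have BA: "grp_conj G B A = B \<otimes> t [^] l"
  proof -
    have "grp_conj G B A = grp_conj G (grp_conj G B a) a"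
      by (simp add: A_def numeral_2_eq_2 grp_conj_conj)
    also have "\<dots> = grp_conj G (inv B \<otimes> D \<otimes> w2) a" by (simp only: conj)
    also have "\<dots> = inv (grp_conj G B a) \<otimes> grp_conj G D a \<otimes> w2"
      using w2 by (simp add: grp_conj_mult grp_conj_inv)
    also have "\<dots> = w2 \<otimes> (inv D \<otimes> B \<otimes> D \<otimes> t [^] l) \<otimes> w2"
      using w2 t by (simp add: conj Da N_inv word_simps)
    also have "\<dots> = inv D \<otimes> (B \<otimes> D) \<otimes> t [^] l \<otimes> (w2 \<otimes> w2)"
      using w2 t N_comm[of w2 "inv D \<otimes> B \<otimes> D \<otimes> t [^] l"] by (simp add: m_assoc)
    also have "\<dots> = B \<otimes> t [^] l"
      using w2 t by (simp add: N_sq word_simps flip: CA)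
    finally show ?thesis .
  qed
  have AB: "grp_conj G A B = A \<otimes> \<alpha> t [^] l"
    using swap.hom_grp_conj[of B A] t by (simp add: BA swap.hom_nat_pow)
  \<comment> \<open>\<open>t^l\<close> is the commutator of \<open>B\<close> and \<open>A\<close>.
    The swap turns it into the opposite commutator, its inverse, and elements of \<open>N\<close>
    are their own inverses.\<close>
  have tl: "\<alpha> (t [^] l) = t [^] l"
  proof -
    have 1: "B \<otimes> A = A \<otimes> (B \<otimes> t [^] l)" and 2: "A \<otimes> B = B \<otimes> (A \<otimes> \<alpha> t [^] l)"
      using BA AB t by (simp_all add: grp_conj_eq_iff)
    have "A \<otimes> B = B \<otimes> A \<otimes> \<alpha> t [^] l" using 2 t by (simp add: m_assoc)
    also have "\<dots> = A \<otimes> B \<otimes> (t [^] l \<otimes> \<alpha> t [^] l)" using t by (simp add: 1 m_assoc)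
    finally have "t [^] l \<otimes> \<alpha> t [^] l = \<one>" using t by (simp add: r_cancel_one')
    then have "\<alpha> t [^] l = inv (t [^] l)"
      using t by (metis N_closed N_inv N_pow N_swap inv_equality)
    then show ?thesis using t by (simp add: N_inv swap.hom_nat_pow)
  qed

  have l0: "l = 0"
  proof (rule ccontr)
    assume "l \<noteq> 0"
    then have l1: "l = 1" and "4 dvd q" using kl by auto
    \<comment> \<open>With \<open>p\<close> even, the \<open>p\<close>-th power of \<open>w2\<close>
      vanishes and \<open>c^p\<close> is a power of \<open>z\<close>, so \<open>t = zb c^p\<close>
      is \<open>zb\<close> or \<open>za\<close>.\<close>
    then obtain p where p: "q = 2 * p" "even p" by (elim dvdE) simp
    have bq: "b [^] q = B [^] p" by (simp add: B_def p nat_pow_pow)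
    have D1: "D = c" using l1 by (simp add: D_def)
    have "c [^] p \<in> {\<one>, z}"
    proof -
      obtain p' where p': "p = 2 * p'" using p by (elim evenE)
      have "c [^] (2::nat) = z" by (simp add: numeral_2_eq_2 c_sq)
      then have "c [^] p = z [^] p'"
        unfolding p' by (simp only: nat_pow_pow[symmetric] c_closed)
      moreover have "z [^] p' \<in> {\<one>, z}" by (induction p') (auto simp: z_sq)
      ultimately show ?thesis by simp
    qed
    then have cp: "c [^] p \<in> N" "zb \<otimes> c [^] p \<in> {za, zb}" by (auto simp: z_mult)
    have "grp_conj G (b [^] q) a = (inv B \<otimes> (c \<otimes> w2)) [^] p"
      using w2 by (simp add: bq grp_conj_pow conj D1 m_assoc)
    also have "\<dots> = inv B [^] p \<otimes> (c \<otimes> w2) [^] p"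
    proof (rule pow_mult_distrib)
      show "inv B \<otimes> (c \<otimes> w2) = c \<otimes> w2 \<otimes> inv B"
        using w2 N_comm[of w2 "inv B"] CA'(4) by (simp add: D1 m_assoc) (simp flip: m_assoc)
    qed (use w2 in simp_all)
    also have "\<dots> = inv (b [^] q) \<otimes> c [^] p"
      using w2 p(2) by (simp add: pow_mult_N N_pow_even nat_pow_inv bq)
    also have "inv (b [^] q) = b [^] q \<otimes> zb"
    proof (rule inv_equality)
      have "b [^] q \<otimes> zb \<otimes> b [^] q = b [^] q \<otimes> b [^] q \<otimes> zb"
        using zb_comm[of "b [^] q"] by (simp add: m_assoc)
      also have "b [^] q \<otimes> b [^] q = zb" by (simp add: nat_pow_mult zb_def flip: mult_2 m_eq_double)
      finally show "b [^] q \<otimes> zb \<otimes> b [^] q = \<one>" by (simp add: z_sq)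
    qed simp_all
    finally have "grp_conj G (b [^] q) a = b [^] q \<otimes> (zb \<otimes> c [^] p)"
      by (simp add: m_assoc)
    moreover have "grp_conj G (a [^] q) a = a [^] q"
      by (simp add: grp_conj_eq_self commute_pow_right)
    ultimately have "grp_conj G c a = c \<otimes> (zb \<otimes> c [^] p)"
      by (simp add: c_def[of] grp_conj_mult m_assoc)
    then have "t = zb \<otimes> c [^] p" using t cp by simp
    then have "t = za \<or> t = zb" using cp by simp
    moreover have "\<alpha> t = t" using tl t by (simp add: l1)
    ultimately show False using z_ne by auto
  qed
  have conj: "grp_conj G B a = inv B \<otimes> w2" and conj': "grp_conj G A b = inv A \<otimes> \<alpha> w2"
    using conj conj' w2 by (simp_all add: l0 D_def)

  obtain s where s: "s \<in> N" "grp_conj G c b = c \<otimes> s" using c_conj[of b] by auto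
  have Cb: "C \<otimes> b = b \<otimes> (C \<otimes> s [^] k)"
    using s by (simp add: C_def grp_conj_pow pow_mult_N flip: grp_conj_eq_iff)
  \<comment> \<open>Two values of the conjugate of \<open>b^2\<close> by \<open>a\<close> are
    compared: the lifted relation, and the square of \<open>b [b, a]\<close>, in which
    \<open>w1\<close> cancels. The factor \<open>s^k\<close> arises from moving \<open>C\<close>
    past \<open>b\<close>.\<close>
  have E2: "w2 = \<alpha> w2 \<otimes> (z [^] k \<otimes> s [^] k)"
  proof -
    define Y where "Y = A \<otimes> inv B \<otimes> C"
    have [simp]: "Y \<in> carrier G" by (simp add: Y_def)
    have Yb: "b \<otimes> A \<otimes> inv b = inv A \<otimes> \<alpha> w2"
    proof -
      have "inv (grp_conj G A b) = inv (inv A \<otimes> \<alpha> w2)" by (simp only: conj')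
      then have "grp_conj G (inv A) b = \<alpha> w2 \<otimes> A"
        using w2 by (simp add: grp_conj_inv inv_mult_group N_inv)
      then have "inv A \<otimes> b = b \<otimes> (\<alpha> w2 \<otimes> A)" using w2 by (simp add: grp_conj_eq_iff)
      also have "\<dots> = \<alpha> w2 \<otimes> (b \<otimes> A)" using w2 by (intro N_left_comm) simp_all
      finally have "\<alpha> w2 \<otimes> (inv A \<otimes> b) = \<alpha> w2 \<otimes> \<alpha> w2 \<otimes> (b \<otimes> A)" using w2 by (simp add: m_assoc)
      then have "b \<otimes> A = \<alpha> w2 \<otimes> (inv A \<otimes> b)" using w2 by (simp add: N_sq)
      then show ?thesis using w2 N_comm[of "\<alpha> w2" "inv A"] by (simp add: m_assoc)
    qed
    have "grp_conj G B a = grp_conj G b a \<otimes> grp_conj G b a"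
      by (simp add: B_def numeral_2_eq_2 grp_conj_mult)
    also have "\<dots> = (b \<otimes> Y \<otimes> w1) \<otimes> (b \<otimes> Y \<otimes> w1)"
      using w1 by (simp add: grp_conj_eq_mult_comm comm Y_def m_assoc)
    also have "\<dots> = b \<otimes> Y \<otimes> (w1 \<otimes> (b \<otimes> Y)) \<otimes> w1"
      using w1 by (simp add: m_assoc)
    also have "\<dots> = b \<otimes> Y \<otimes> (b \<otimes> Y)"
      using w1 N_comm[of w1 "b \<otimes> Y"] by (simp add: m_assoc N_sq)
    also have "\<dots> = b \<otimes> A \<otimes> inv B \<otimes> (C \<otimes> b) \<otimes> Y"
      by (simp add: Y_def m_assoc)
    also have "\<dots> = b \<otimes> A \<otimes> (inv B \<otimes> b) \<otimes> C \<otimes> s [^] k \<otimes> Y"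
      using s by (simp add: Cb m_assoc)
    also have "inv B \<otimes> b = inv b"
      by (simp add: B_def numeral_2_eq_2 word_simps)
    also have "b \<otimes> A \<otimes> inv b \<otimes> C \<otimes> s [^] k \<otimes> Y = inv A \<otimes> \<alpha> w2 \<otimes> C \<otimes> (s [^] k \<otimes> Y)"
      using s by (simp only: Yb) (simp add: m_assoc w2)
    also have "\<dots> = inv A \<otimes> \<alpha> w2 \<otimes> (C \<otimes> A) \<otimes> inv B \<otimes> C \<otimes> s [^] k"
      using s w2 N_comm[of "s [^] k" Y] by (simp add: Y_def m_assoc)
    also have "\<dots> = inv A \<otimes> (\<alpha> w2 \<otimes> A) \<otimes> (C \<otimes> inv B) \<otimes> C \<otimes> s [^] k"
      using s w2 by (simp add: CA m_assoc)
    also have "\<dots> = \<alpha> w2 \<otimes> inv B \<otimes> (C \<otimes> C) \<otimes> s [^] k"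
      using s w2 N_comm[of "\<alpha> w2" A] by (simp add: CA' word_simps)
    also have "\<dots> = inv B \<otimes> (\<alpha> w2 \<otimes> (z [^] k \<otimes> s [^] k))"
      using s w2 N_comm[of "\<alpha> w2" "inv B"] by (simp add: C_def c_pow_sq m_assoc)
    finally have "inv B \<otimes> w2 = inv B \<otimes> (\<alpha> w2 \<otimes> (z [^] k \<otimes> s [^] k))"
      by (simp add: conj)
    then show ?thesis using w2 s by simp
  qed

  have k0: "k = 0"
  proof (rule ccontr)
    assume "k \<noteq> 0"
    then have k1: "k = 1" and "4 dvd q" using kl by auto
    then obtain p where p: "q = 2 * p" "even p" by (elim dvdE) simp
    have aq: "a [^] q = A [^] p" by (simp add: A_def p nat_pow_pow)
    have "grp_conj G (a [^] q) b = inv (a [^] q)"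
      using w2 p(2) by (simp add: aq grp_conj_pow conj' pow_mult_N N_pow_even nat_pow_inv)
    also have "\<dots> = a [^] q \<otimes> za"
    proof (rule inv_equality)
      have "a [^] q \<otimes> za \<otimes> a [^] q = a [^] q \<otimes> a [^] q \<otimes> za"
        using za_comm[of "a [^] q"] by (simp add: m_assoc)
      also have "a [^] q \<otimes> a [^] q = za" by (simp add: nat_pow_mult za_def flip: mult_2 m_eq_double)
      finally show "a [^] q \<otimes> za \<otimes> a [^] q = \<one>" by (simp add: z_sq)
    qed simp_all
    moreover have "grp_conj G (b [^] q) b = b [^] q"
      by (simp add: grp_conj_eq_self commute_pow_right)
    ultimately have "grp_conj G c b = a [^] q \<otimes> (za \<otimes> b [^] q)"
      by (simp add: c_def grp_conj_mult m_assoc)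
    also have "\<dots> = c \<otimes> za" using za_comm[of "b [^] q"] by (simp add: c_def m_assoc)
    finally have "s = za" using s by simp
    then have "w2 = \<alpha> w2 \<otimes> zb" using E2 k1 by (simp add: z_mult)
    then have "w2 \<otimes> \<alpha> w2 = \<alpha> w2 \<otimes> zb \<otimes> \<alpha> w2" by simp
    also have "\<dots> = \<alpha> w2 \<otimes> \<alpha> w2 \<otimes> zb" using w2 zb_comm[of "\<alpha> w2"] by (simp add: m_assoc)
    also have "\<dots> = zb" using w2 by (simp add: N_sq)
    finally show False using N_mult_swap[OF w2] z_ne by auto
  qed
  \<comment> \<open>With \<open>k = 0\<close>, \<open>E2\<close> and \<open>E1\<close> say that
    \<open>w2\<close> and \<open>w1\<close> are fixed by \<alpha>, hence powers of \<open>z\<close>;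
    their exponents become the parameters of \<open>G\<close>.\<close>
  have "\<alpha> w2 = w2" using E2 w2 by (simp add: k0)
  then have w2': "w2 = \<one> \<or> w2 = z" using w2 N_swap_fixed by simp
  have "\<alpha> w1 = w1"
  proof -
    have "w1 \<otimes> \<alpha> w1 = w1 \<otimes> w1" using E1 w1 by (simp add: k0 N_sq)
    then show ?thesis using w1 by simp
  qed
  then have w1': "w1 = \<one> \<or> w1 = z" using w1 N_swap_fixed by simp
  obtain k' l' :: nat where k'l': "k' \<in> {0, 1}" "w1 = z [^] k'" "l' \<in> {0, 1}" "w2 = z [^] l'"
    using w1' w2' by (metis insertCI nat_pow_0 nat_pow_eone z_closed(3))
  have "G2_type G n k' l' a b"
  proof -
    have "n div 2 = m" by (simp add: n_eq)
    then have zz: "a [^] (n div 2) \<otimes> b [^] (n div 2) = z" by (simp add: z_def za_def zb_def)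
    show ?thesis
      unfolding G2_type_def Let_def zz
      using k'l' \<open>\<alpha> w2 = w2\<close> conj conj' comm BA w1
      by (simp add: int_pow_minus_two a_pow_eq_one_iff b_pow_eq_one_iff grp_comm_eq_one_iff
          k0 l0 C_def flip: A_def B_def)
  qed
  then show ?thesis using k'l' by blast
qed

end


text \<open>The clause on \<open>e = 2\<close> supplies the divisibility condition of
  \<open>G2_type_step\<close>: in the step \<open>q = 2^(e - 1)\<close>, which fails to be divisible
  by 4 exactly when the quotient has order parameter 4.\<close>

lemma isobicyclic_dichotomy:
  fixes G :: "('a, 'b) monoid_scheme"
  assumes "isobicyclic G (2 ^ e) a b \<alpha>" "e \<ge> 2"
  shows "cyclic_type G (2 ^ e) a b \<or>
    (\<exists>k\<in>{0, 1}. \<exists>l\<in>{0, 1}. (e = 2 \<longrightarrow> k = 0 \<and> l = 0) \<and> G2_type G (2 ^ e) k l a b)"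
  using assms(2,1)
proof (induction e arbitrary: G a b \<alpha> rule: nat_induct_at_least)
  case (base G a b \<alpha>)
  interpret isobicyclic G "2 ^ 2" a b \<alpha> by (rule base)
  interpret isobicyclic_quarter G "2 ^ 2" a b \<alpha> 1 2 0 1
    by unfold_locales simp_all
  show ?case using type_four by auto
next
  case (Suc e G a b \<alpha>)
  interpret isobicyclic G "2 ^ Suc e" a b \<alpha> by (rule Suc.prems)
  obtain g where e: "e = Suc (Suc g)" using Suc.hyps by (metis One_nat_def Suc_1 Suc_le_D Suc_le_mono)
  interpret isobicyclic_eighth G "2 ^ Suc e" a b \<alpha> e "2 ^ e" "Suc g" "2 ^ Suc g"
    by unfold_locales (simp_all add: e)
  obtain H :: "('a, 'b) monoid_scheme" and \<phi> \<alpha>' where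
    H: "isobicyclic_half H (2 ^ e) (\<phi> a) (\<phi> b) \<alpha>' (Suc g) (2 ^ Suc g)" "group_hom G H \<phi>"
    and eqD: "\<And>x y. x \<in> carrier G \<Longrightarrow> y \<in> carrier G \<Longrightarrow> \<phi> x = \<phi> y \<Longrightarrow> \<exists>w\<in>N. x = y \<otimes>\<^bsub>G\<^esub> w"
    by (rule quarter_quotient) (rule that; assumption)
  have "isobicyclic H (2 ^ e) (\<phi> a) (\<phi> b) \<alpha>'" using H(1) by (rule isobicyclic_half.axioms)
  from Suc.IH[OF this] consider "cyclic_type H (2 ^ e) (\<phi> a) (\<phi> b)"
    | k l where "k \<in> {0, 1}" "l \<in> {0, 1}" "e = 2 \<longrightarrow> k = 0 \<and> l = 0"
      "G2_type H (2 ^ e) k l (\<phi> a) (\<phi> b)"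
    by blast
  then show ?case
  proof cases
    case 1
    then show ?thesis using cyclic_type_step[OF H(2) eqD] by blast
  next
    case 2
    have "4 dvd (2::nat) ^ Suc g" if e2: "e \<noteq> 2"
    proof -
      obtain g' where "g = Suc g'" using e2 e by (cases g) auto
      then show ?thesis by simp
    qed
    then have "\<exists>k\<in>{0, 1}. \<exists>l\<in>{0, 1}. G2_type G (2 ^ Suc e) k l a b"
      using 2 by (intro G2_type_step[OF H(2) eqD 2(4)]) auto
    then show ?thesis using Suc.hyps by auto
  qed
qed

text \<open>The cyclic normal subgroup consists of the powers of \<open>h\<close>. Since
  \<open>b = a h\<close>, the element \<open>b\<close> normalizes it as soon as \<open>a\<close>
  does, and \<open>a\<close> and \<open>b\<close> have the same coset, which generates the
  quotient.\<close>

lemma (in isobicyclic) metacyclic_of_cyclic_type: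
  assumes "cyclic_type G n a b"
  shows "metacyclic G"
proof -
  define h where "h = inv a \<otimes> b"
  have h [simp]: "h \<in> carrier G" by (simp add: h_def)
  obtain r :: nat where r: "grp_conj G h a = h [^] r"
    using assms by (auto simp: cyclic_type_def h_def)
  define K where "K = generate G {h}"
  have K: "K = {h [^] (k::int) | k. k \<in> UNIV}" by (simp add: K_def generate_pow)
  interpret K: subgroup K G unfolding K_def by (rule generate_is_subgroup) simp
  have K_a: "grp_conj G x a \<in> K" if "x \<in> K" for x
    using that r by (auto simp: K grp_conj_int_pow int_pow_pow simp flip: int_pow_int)
  have b: "b = a \<otimes> h" by (simp add: h_def word_simps)
  have "h \<in> K" by (simp add: K_def generate.incl)
  then have "grp_conj G x h \<in> K" if "x \<in> K" for x
    using that by (simp add: grp_conj_def)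
  then have K_b: "grp_conj G x b \<in> K" if "x \<in> K" for x
    using that K_a[OF that] K.mem_carrier by (simp add: b flip: grp_conj_conj)
  have pow: "grp_conj G x (g [^] (i::nat)) \<in> K"
    if "\<And>x. x \<in> K \<Longrightarrow> grp_conj G x g \<in> K" "g \<in> carrier G" "x \<in> K" for g x i
  proof (induction i)
    case 0
    then show ?case using that by (simp add: grp_conj_def K.mem_carrier)
  next
    case (Suc i)
    then show ?case using that by (simp add: K.mem_carrier flip: grp_conj_conj)
  qed
  have "K \<lhd> G"
  proof (rule normal_invI)
    fix x y assume "x \<in> carrier G" and y: "y \<in> K"
    \<comment> \<open>Factoring \<open>inv x\<close> into natural powers of \<open>a\<close> and
      \<open>b\<close> makes the one-sided inclusions \<open>K_a\<close> and \<open>K_b\<close>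
      sufficient for normality.\<close>
    then have "inv x \<in> carrier G" by simp
    then obtain i j :: nat where "inv x = a [^] i \<otimes> b [^] j" using factorization by blast
    moreover have "grp_conj G y (a [^] i) \<in> K" by (rule pow[OF K_a _ y]) simp_all
    then have "grp_conj G (grp_conj G y (a [^] i)) (b [^] j) \<in> K" by (intro pow[OF K_b]) simp_all
    ultimately have "grp_conj G y (inv x) \<in> K" using y by (simp add: grp_conj_conj K.mem_carrier)
    then show "x \<otimes> y \<otimes> inv x \<in> K" using \<open>x \<in> carrier G\<close> by (simp add: grp_conj_def)
  qed (rule K.subgroup_axioms)
  then interpret K: normal K G .
  have "subgroup_generated G K = subgroup_generated G {h}"
    using K.carrier_subgroup_generated_subgroup by (simp add: subgroup_generated_def K_def)
  then have cyc: "cyclic_group (subgroup_generated G K)" by (simp add: cyclic_group_generated)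
  interpret Q: group "G Mod K" by (rule K.factorgroup_is_group)
  interpret Q: group_hom G "G Mod K" "\<lambda>x. K #> x"
    using K.r_coset_hom_Mod by unfold_locales
  have "K #> b = K #> a"
  proof -
    have "K #> h = \<one>\<^bsub>G Mod K\<^esub>" using \<open>h \<in> K\<close> by (simp add: K.rcos_const)
    then show ?thesis using Q.hom_mult[of a h] Q.r_one[of "K #> a"] by (simp add: b del: mult_FactGroup one_FactGroup)
  qed
  have "carrier (G Mod K) = range (\<lambda>k::int. (K #> a) [^]\<^bsub>G Mod K\<^esub> k)"
  proof (intro equalityI subsetI)
    fix V assume "V \<in> carrier (G Mod K)"
    then obtain x where "x \<in> carrier G" and V: "V = K #> x" by (auto simp: carrier_FactGroup)
    then obtain i j :: nat where "x = a [^] i \<otimes> b [^] j" using factorization by blast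
    then have "V = (K #> a) [^]\<^bsub>G Mod K\<^esub> int (i + j)"
      unfolding V int_pow_int by (simp add: Q.hom_nat_pow \<open>K #> b = K #> a\<close> Q.nat_pow_mult
        del: mult_FactGroup)
    then show "V \<in> range (\<lambda>k::int. (K #> a) [^]\<^bsub>G Mod K\<^esub> k)" by blast
  qed auto
  then have "cyclic_group (G Mod K)" unfolding Q.cyclic_group using Q.hom_closed[OF a_closed] by blast
  with cyc \<open>K \<lhd> G\<close> show ?thesis unfolding metacyclic_def by blast
qed

lemma isobicyclic_triple_imp_isobicyclic:
  fixes G (structure)
  assumes "isobicyclic_triple n G a b" "n > 0"
  shows "\<exists>\<alpha>. isobicyclic G n a b \<alpha>"
proof -
  interpret group G using assms by (simp add: isobicyclic_triple_def)
  have a [simp]: "a \<in> carrier G" and b [simp]: "b \<in> carrier G" and "finite (carrier G)"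
    and "ord a = n" "ord b = n"
    and fac: "carrier G = generate G {a} <#> generate G {b}"
    and disj: "generate G {a} \<inter> generate G {b} = {\<one>}"
    using assms unfolding isobicyclic_triple_def by blast+
  obtain \<alpha> where \<alpha>: "\<alpha> \<in> iso G G" "\<alpha> a = b" "\<alpha> b = a"
    using assms unfolding isobicyclic_triple_def by blast
  have gen: "generate G {x} = {x [^] k | k. k \<in> (UNIV :: nat set)}" if "x \<in> carrier G" for x
    using generate_pow_on_finite_carrier[OF \<open>finite (carrier G)\<close> that] .
  have "isobicyclic G n a b \<alpha>"
  proof (unfold_locales, goal_cases)
    case (5 x)
    then have "x \<in> generate G {a} <#> generate G {b}" using fac by simp
    then show ?case unfolding gen[OF a] gen[OF b] set_mult_def by blast
  next
    case (6 i j)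
    then have "a [^] i \<in> generate G {a} \<inter> generate G {b}" unfolding gen[OF a] gen[OF b] by blast
    then show ?case using disj by simp
  qed (use \<alpha> assms \<open>ord a = n\<close> \<open>ord b = n\<close> in \<open>simp_all add: pow_eq_id iso_def\<close>)
  then show ?thesis by blast
qed



section \<open>Presentations\<close>

primrec eval_word :: "('a, 'm) monoid_scheme \<Rightarrow> ('g \<Rightarrow> 'a) \<Rightarrow> ('g \<times> bool) list \<Rightarrow> 'a" where
  "eval_word G f [] = \<one>\<^bsub>G\<^esub>"
| "eval_word G f (p # w) =
     (if snd p then f (fst p) else inv\<^bsub>G\<^esub> f (fst p)) \<otimes>\<^bsub>G\<^esub> eval_word G f w"

section \<open>Homomorphisms out of the free group\<close>

context group begin

lemma eval_word_closed [simp]: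
  "(\<And>x. f x \<in> carrier G) \<Longrightarrow> eval_word G f w \<in> carrier G"
  by (induction w) simp_all

lemma eval_word_append:
  "(\<And>x. f x \<in> carrier G) \<Longrightarrow> eval_word G f (u @ v) = eval_word G f u \<otimes> eval_word G f v"
  by (induction u) (simp_all add: m_assoc)

lemma eval_word_free_eq:
  assumes "free_eq u v" "\<And>x. f x \<in> carrier G"
  shows "eval_word G f u = eval_word G f v"
  using assms(1)
proof induction
  case (cancel u x s v)
  then show ?case using assms(2) by (simp add: eval_word_append word_simps)
qed simp_all

lemma free_group_lift:
  fixes f :: "'g \<Rightarrow> 'a"
  assumes f: "\<And>x. f x \<in> carrier G"
  shows "\<exists>\<psi>\<in>hom free_group G. \<forall>x. \<psi> (free_gen x) = f x"
proof -
  define \<psi> where "\<psi> V = eval_word G f (SOME v. v \<in> V)" for V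
  have \<psi>: "\<psi> (free_rel `` {v}) = eval_word G f v" for v
  proof -
    have "v \<in> free_rel `` {v}" by (simp add: free_rel_def free_eq.refl)
    then have "(SOME u. u \<in> free_rel `` {v}) \<in> free_rel `` {v}" by (rule someI)
    then have "free_eq v (SOME u. u \<in> free_rel `` {v})" by (simp add: free_rel_def)
    then show ?thesis using eval_word_free_eq f unfolding \<psi>_def by metis
  qed
  have "\<psi> \<in> hom free_group G"
  proof (rule homI)
    fix V W :: "('g \<times> bool) list set"
    assume "V \<in> carrier free_group" "W \<in> carrier free_group"
    then obtain v w where "V = free_rel `` {v}" "W = free_rel `` {w}"
      by (auto simp: free_group_def quotient_def)
    then show "\<psi> V \<in> carrier G" "\<psi> (V \<otimes>\<^bsub>free_group\<^esub> W) = \<psi> V \<otimes> \<psi> W"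
      using f by (simp_all add: free_mult_class \<psi> eval_word_append)
  qed
  moreover have "\<psi> (free_gen x) = f x" for x
    using f by (simp add: free_gen_def \<psi>)
  ultimately show ?thesis by blast
qed

end

lemma free_gen_closed [simp]: "free_gen x \<in> carrier free_group"
  by (auto simp: free_gen_def free_group_def quotient_def)

lemma inv_free_gen: "inv\<^bsub>free_group\<^esub> free_gen x = free_rel `` {[(x, False)]}"
proof -
  interpret F: group free_group by (rule group_free_group)
  have "free_rel `` {[(x, False)]} \<otimes>\<^bsub>free_group\<^esub> free_gen x = free_rel `` {[]}"
    using free_eq.cancel[of "[]" x False "[]"]
    by (simp add: free_gen_def free_mult_class free_class_eq_iff)
  also have "\<dots> = \<one>\<^bsub>free_group\<^esub>" by (simp add: free_group_def)
  finally show ?thesis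
    by (rule F.inv_equality) (auto simp: free_group_def quotient_def free_gen_def)
qed

text \<open>Letters are prefixed one at a time, matching a normal form that is stable under left
  multiplication by generators.\<close>

lemma free_group_induct [consumes 1, case_names one gen inv_gen]:
  assumes "V \<in> carrier free_group"
    and one: "P \<one>\<^bsub>free_group\<^esub>"
    and gen: "\<And>x V. V \<in> carrier free_group \<Longrightarrow> P V \<Longrightarrow> P (free_gen x \<otimes>\<^bsub>free_group\<^esub> V)"
    and inv_gen: "\<And>x V. V \<in> carrier free_group \<Longrightarrow> P V \<Longrightarrow>
      P (inv\<^bsub>free_group\<^esub> free_gen x \<otimes>\<^bsub>free_group\<^esub> V)"
  shows "P V"
proof -
  have "P (free_rel `` {v})" for v
  proof (induction v)
    case Nil
    then show ?case using one by (simp add: free_group_def)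
  next
    case (Cons p v)
    obtain x s where p: "p = (x, s)" by force
    have eq: "free_rel `` {p # v} = (if s then free_gen x else inv\<^bsub>free_group\<^esub> free_gen x)
        \<otimes>\<^bsub>free_group\<^esub> free_rel `` {v}"
      by (simp add: p inv_free_gen, simp add: free_gen_def free_mult_class)
    have "free_rel `` {v} \<in> carrier free_group"
      by (auto simp: free_group_def quotient_def)
    then show ?case using gen inv_gen Cons unfolding eq by simp
  qed
  then show ?thesis using assms(1) by (auto simp: free_group_def quotient_def)
qed

text \<open>First isomorphism theorem for the lift of \<open>f\<close> to the free group. Its
  existence is proved inside, so the conditions range over every homomorphism with the prescribed
  values; \<open>inj\<close> may assume that the normal closure is already killed.\<close>

lemma has_presentationI:
  fixes G :: "('a, 'm) monoid_scheme" and f :: "'g \<Rightarrow> 'a"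
  assumes "group G" and f: "\<And>x. f x \<in> carrier G"
    and R: "R \<subseteq> carrier free_group \<times> carrier free_group"
    and sat: "\<And>\<psi> u v. group_hom free_group G \<psi> \<Longrightarrow> (\<And>x. \<psi> (free_gen x) = f x) \<Longrightarrow>
      (u, v) \<in> R \<Longrightarrow> \<psi> u = \<psi> v"
    and surj: "\<And>\<psi>. group_hom free_group G \<psi> \<Longrightarrow> (\<And>x. \<psi> (free_gen x) = f x) \<Longrightarrow>
      carrier G \<subseteq> \<psi> ` carrier free_group"
    and inj: "\<And>\<psi> V. group_hom free_group G \<psi> \<Longrightarrow> (\<And>x. \<psi> (free_gen x) = f x) \<Longrightarrow>
      (\<And>V. V \<in> normal_closure free_group (relators R) \<Longrightarrow> \<psi> V = \<one>\<^bsub>G\<^esub>) \<Longrightarrow>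
      V \<in> carrier free_group \<Longrightarrow> \<psi> V = \<one>\<^bsub>G\<^esub> \<Longrightarrow> V \<in> normal_closure free_group (relators R)"
  shows "has_presentation G f R"
proof -
  interpret G: group G by fact
  obtain \<psi> where "\<psi> \<in> hom free_group G" and gen: "\<And>x. \<psi> (free_gen x) = f x"
    using G.free_group_lift[of f] f by blast
  then interpret \<psi>: group_hom free_group G \<psi>
    by (simp add: group_hom_def group_hom_axioms_def group_free_group G.is_group)
  let ?N = "normal_closure free_group (relators R)" and ?K = "kernel free_group G \<psi>"
  have rel: "relators R \<subseteq> ?K"
    using R sat[OF \<psi>.group_hom_axioms gen] by (fastforce simp: relators_def kernel_def)
  have "?N \<subseteq> ?K"
    unfolding normal_closure_def
  proof (rule \<psi>.generate_subgroup_incl[OF _ \<psi>.subgroup_kernel], safe)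
    fix V s :: "('g \<times> bool) list set" assume "V \<in> carrier free_group" "s \<in> relators R"
    then show "inv\<^bsub>free_group\<^esub> V \<otimes>\<^bsub>free_group\<^esub> s \<otimes>\<^bsub>free_group\<^esub> V \<in> ?K"
      using rel by (auto simp: kernel_def)
  qed
  then have kill: "\<psi> V = \<one>\<^bsub>G\<^esub>" if "V \<in> ?N" for V using that by (auto simp: kernel_def)
  have "?K = ?N"
    using \<open>?N \<subseteq> ?K\<close> inj[OF \<psi>.group_hom_axioms gen kill] by (auto simp: kernel_def)
  moreover have "\<psi> ` carrier free_group = carrier G"
    using surj[OF \<psi>.group_hom_axioms gen] by auto
  ultimately have iso: "(\<lambda>V. the_elem (\<psi> ` V)) \<in> iso (presented_group R) G"
    using \<psi>.FactGroup_iso_set by (simp add: presented_group_def)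
  have "the_elem (\<psi> ` presented_gen R x) = f x" for x
  proof -
    have K: "presented_gen R x = ?K #>\<^bsub>free_group\<^esub> free_gen x"
      by (simp add: presented_gen_def \<open>?K = ?N\<close>)
    have "\<psi> V = f x" if V: "V \<in> presented_gen R x" for V
    proof -
      obtain U where U: "U \<in> ?K" "V = U \<otimes>\<^bsub>free_group\<^esub> free_gen x"
        using V unfolding K r_coset_def by blast
      then have "U \<in> carrier free_group" "\<psi> U = \<one>\<^bsub>G\<^esub>" by (simp_all add: kernel_def)
      then show ?thesis using f by (simp add: U(2) gen)
    qed
    moreover have "free_gen x \<in> presented_gen R x"
      unfolding K by (rule \<psi>.rcos_self[OF free_gen_closed \<psi>.subgroup_kernel])
    ultimately have "\<psi> ` presented_gen R x = {f x}" by (auto simp: image_iff)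
    then show ?thesis by simp
  qed
  then show ?thesis unfolding has_presentation_def by (intro bexI[OF _ iso]) simp
qed

lemma hom_presented_group:
  fixes R defines "N \<equiv> normal_closure free_group (relators R)"
  assumes R: "R \<subseteq> carrier free_group \<times> carrier free_group"
  shows "group_hom free_group (presented_group R) (\<lambda>V. N #>\<^bsub>free_group\<^esub> V)"
    and "\<And>u v. (u, v) \<in> R \<Longrightarrow> N #>\<^bsub>free_group\<^esub> u = N #>\<^bsub>free_group\<^esub> v"
    and "subgroup N free_group"
proof -
  interpret F: group free_group by (rule group_free_group)
  have rel: "relators R \<subseteq> carrier free_group" using R by (auto simp: relators_def)
  interpret N: normal N free_group
    unfolding N_def by (rule F.normal_normal_closure[OF rel])
  show "subgroup N free_group" by (rule N.subgroup_axioms)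
  show "group_hom free_group (presented_group R) (\<lambda>V. N #>\<^bsub>free_group\<^esub> V)"
    using N.r_coset_hom_Mod group_presented_group[OF R]
    by (simp add: group_hom_def group_hom_axioms_def F.is_group presented_group_def flip: N_def)
  show "N #>\<^bsub>free_group\<^esub> u = N #>\<^bsub>free_group\<^esub> v" if uv: "(u, v) \<in> R" for u v
  proof -
    let ?r = "u \<otimes>\<^bsub>free_group\<^esub> inv\<^bsub>free_group\<^esub> v"
    have [simp]: "u \<in> carrier free_group" "v \<in> carrier free_group" using R uv by auto
    have r: "?r \<in> relators R" using uv by (auto simp: relators_def)
    have "inv\<^bsub>free_group\<^esub> \<one>\<^bsub>free_group\<^esub> \<otimes>\<^bsub>free_group\<^esub> ?r \<otimes>\<^bsub>free_group\<^esub> \<one>\<^bsub>free_group\<^esub> \<in> N"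
      unfolding N_def normal_closure_def by (rule generate.incl) (use r in blast)
    then have "?r \<in> N" by simp
    moreover have "u = ?r \<otimes>\<^bsub>free_group\<^esub> v" by (simp add: F.m_assoc)
    ultimately have "u \<in> N #>\<^bsub>free_group\<^esub> v" by (auto simp: r_coset_def)
    then show ?thesis using F.repr_independence[of u N v] N.subgroup_axioms by simp
  qed
qed



text \<open>The relations alone make \<open>z\<close> central, so any power of \<open>z\<close> can
  be split between the power of \<open>x\<close> and that of \<open>y\<close>. Moving
  \<open>y\<close> past even powers of \<open>x\<close> inverts them up to such factors, and one
  remaining \<open>x\<close> is handled by the commutator relation.\<close>

lemma (in group) G2_type_normal_form:
  assumes x [simp]: "x \<in> carrier G" and y [simp]: "y \<in> carrier G"
    and G2: "G2_type G n k l x y" and n: "4 dvd n" "l = 0 \<or> 8 dvd n"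
  shows "\<exists>(u::int) (v::int). y \<otimes> (x [^] (i::int) \<otimes> y [^] (j::int)) = x [^] u \<otimes> y [^] v"
proof -
  define m where "m = n div 2"
  define p where "p = n div 4"
  have m: "m = 2 * p" and nm: "n = 2 * m" using n by (auto simp: m_def p_def)
  define A B z where "A = x [^] (2::nat)" and "B = y [^] (2::nat)" and "z = x [^] m \<otimes> y [^] m"
  have AB [simp]: "A \<in> carrier G" "B \<in> carrier G" "z \<in> carrier G"
    by (simp_all add: A_def B_def z_def)
  have xn: "x [^] n = \<one>" and yn: "y [^] n = \<one>" and comm0: "grp_comm G B A = \<one>"
    and comm: "grp_comm G y x = A \<otimes> inv B \<otimes> z [^] k"
    and B_conj: "grp_conj G B x = inv B \<otimes> z [^] l"
    and A_conj: "grp_conj G A y = inv A \<otimes> z [^] l"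
    using G2 by (simp_all add: G2_type_def Let_def int_pow_minus_two A_def B_def z_def m_def)
  have xm: "x [^] m = A [^] p" and ym: "y [^] m = B [^] p"
    by (simp_all add: A_def B_def m nat_pow_pow)
  have BA: "B \<otimes> A = A \<otimes> B" using comm0 by (simp add: grp_comm_eq_one_iff grp_conj_eq_iff)
  have zA: "z \<otimes> A = A \<otimes> z" and zB: "z \<otimes> B = B \<otimes> z"
  proof -
    have 1: "A \<otimes> A [^] p = A [^] p \<otimes> A" "A \<otimes> B [^] p = B [^] p \<otimes> A"
      "B \<otimes> A [^] p = A [^] p \<otimes> B" "B \<otimes> B [^] p = B [^] p \<otimes> B"
      using BA by (simp_all add: commute_pow_right)
    then show "z \<otimes> A = A \<otimes> z" "z \<otimes> B = B \<otimes> z"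
      unfolding z_def xm ym by (metis AB(1,2) m_assoc nat_pow_closed)+
  qed
  have xy_m: "x [^] m \<otimes> y [^] m = y [^] m \<otimes> x [^] m"
    unfolding xm ym using BA by (simp add: commute_pow_pow)
  have sq: "x [^] m \<otimes> x [^] m = \<one>" "y [^] m \<otimes> y [^] m = \<one>"
    using xn yn by (simp_all add: nat_pow_mult nm mult_2)
  have zz: "z \<otimes> z = \<one>"
  proof -
    have "z \<otimes> z = x [^] m \<otimes> (y [^] m \<otimes> x [^] m) \<otimes> y [^] m" by (simp add: z_def m_assoc)
    also have "\<dots> = (x [^] m \<otimes> x [^] m) \<otimes> (y [^] m \<otimes> y [^] m)"
      by (simp add: m_assoc flip: xy_m)
    finally show ?thesis by (simp add: sq)
  qed
  \<comment> \<open>\<open>p = n/4\<close> is even when \<open>l\<close> is not 0. Hence the factors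
    \<open>z^l\<close> drop out on passing from \<open>x^2\<close>, \<open>y^2\<close> to
    \<open>x^m\<close>, \<open>y^m\<close>: these are conjugated to their inverses, that is to
    themselves.\<close>
  have zl: "(z [^] l) [^] p = \<one>"
  proof (cases "l = 0")
    case False
    then have "even p" using n by (auto simp: p_def elim!: dvdE)
    then obtain p' where p': "p = 2 * p'" by (elim evenE)
    have "z [^] (2::nat) = \<one>" by (simp add: numeral_2_eq_2 zz)
    moreover have "l * p = 2 * (l * p')" by (simp add: p')
    ultimately have "z [^] (l * p) = \<one>" by (metis AB(3) nat_pow_one nat_pow_pow)
    then show ?thesis by (simp add: nat_pow_pow)
  qed simp
  have pow_conj: "(inv S \<otimes> z [^] l) [^] p = inv (S [^] p)"
    if S: "S \<in> carrier G" "z \<otimes> S = S \<otimes> z" for S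
  proof -
    have "z \<otimes> inv S = inv S \<otimes> z"
      using S by (metis AB(3) grp_conj_eq_iff grp_conj_inv inv_closed)
    then have "inv S \<otimes> z [^] l = z [^] l \<otimes> inv S"
      using S by (intro commute_pow_right) simp_all
    then have "(inv S \<otimes> z [^] l) [^] p = inv S [^] p \<otimes> (z [^] l) [^] p"
      using S by (intro pow_mult_distrib) simp_all
    then show ?thesis using S by (simp add: zl nat_pow_inv)
  qed
  have "grp_conj G (y [^] m) x = inv (y [^] m)" "grp_conj G (x [^] m) y = inv (x [^] m)"
    unfolding xm ym using pow_conj zA zB by (simp_all add: grp_conj_pow B_conj A_conj)
  then have "grp_conj G (y [^] m) x = y [^] m" "grp_conj G (x [^] m) y = x [^] m"
    using sq by (simp_all add: inv_equality)
  then have c: "y [^] m \<otimes> x = x \<otimes> y [^] m" "x [^] m \<otimes> y = y \<otimes> x [^] m"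
    by (simp_all add: grp_conj_eq_iff)
  have zx: "z \<otimes> x = x \<otimes> z"
  proof -
    have "z \<otimes> x = x [^] m \<otimes> x \<otimes> y [^] m" using c by (simp add: z_def m_assoc)
    also have "x [^] m \<otimes> x = x \<otimes> x [^] m" by (simp add: commute_pow_right)
    finally show ?thesis by (simp add: z_def m_assoc)
  qed
  have zy: "z \<otimes> y = y \<otimes> z"
  proof -
    have "z \<otimes> y = x [^] m \<otimes> (y \<otimes> y [^] m)"
      by (simp add: z_def m_assoc commute_pow_right)
    also have "\<dots> = (x [^] m \<otimes> y) \<otimes> y [^] m" by (simp add: m_assoc)
    finally show ?thesis using c by (simp add: z_def m_assoc)
  qed
  have zq: "z [^] (q::nat) = x [^] int (m * q) \<otimes> y [^] int (m * q)" for q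
    unfolding int_pow_int z_def by (simp add: pow_mult_distrib[OF xy_m] nat_pow_pow)
  have z_comm: "z [^] (q::nat) \<otimes> x [^] (i::int) = x [^] i \<otimes> z [^] q"
    "z [^] (q::nat) \<otimes> y [^] (i::int) = y [^] i \<otimes> z [^] q" for q i
  proof -
    have "grp_conj G x (z [^] q) = x" "grp_conj G y (z [^] q) = y"
      using zx zy by (simp_all add: grp_conj_eq_self commute_pow_right)
    then have "grp_conj G (x [^] i) (z [^] q) = x [^] i" "grp_conj G (y [^] i) (z [^] q) = y [^] i"
      by (simp_all add: grp_conj_int_pow)
    then show "z [^] q \<otimes> x [^] i = x [^] i \<otimes> z [^] q" "z [^] q \<otimes> y [^] i = y [^] i \<otimes> z [^] q"
      by (simp_all add: grp_conj_eq_iff)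
  qed
  have yA: "grp_conj G A (inv y) = inv A \<otimes> z [^] l"
  proof -
    have "A \<otimes> y = y \<otimes> (inv A \<otimes> z [^] l)" using A_conj by (simp add: grp_conj_eq_iff)
    then have "inv A \<otimes> (A \<otimes> y) \<otimes> inv (z [^] l) = inv A \<otimes> (y \<otimes> (inv A \<otimes> z [^] l)) \<otimes> inv (z [^] l)"
      by simp
    then have "y \<otimes> inv (z [^] l) = inv A \<otimes> y \<otimes> inv A" by (simp add: word_simps)
    then have "y \<otimes> inv (z [^] l) \<otimes> A = inv A \<otimes> y" by (simp add: word_simps)
    moreover have "inv (z [^] l) = z [^] l"
      by (rule inv_equality) (simp_all add: zz flip: pow_mult_distrib)
    ultimately have "y \<otimes> (z [^] l \<otimes> A) = inv A \<otimes> y" by (simp add: m_assoc)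
    then have "z [^] l \<otimes> (y \<otimes> A) = inv A \<otimes> y"
      using z_comm(2)[of l 1] by (simp flip: m_assoc)
    then have "z [^] l \<otimes> (z [^] l \<otimes> (y \<otimes> A)) = z [^] l \<otimes> (inv A \<otimes> y)" by simp
    moreover have "z [^] l \<otimes> (z [^] l \<otimes> (y \<otimes> A)) = y \<otimes> A"
      by (simp add: zz flip: m_assoc pow_mult_distrib)
    ultimately have "y \<otimes> A = z [^] l \<otimes> (inv A \<otimes> y)" by simp
    also have "\<dots> = inv A \<otimes> z [^] l \<otimes> y"
      using z_comm(1)[of l "-2"] by (simp add: A_def int_pow_minus_two flip: m_assoc)
    finally show ?thesis by (simp add: grp_conj_def m_assoc)
  qed
  \<comment> \<open>The word \<open>x y [y, x]\<close> collapses because \<open>y\<close> inverts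
    \<open>x^2\<close> up to \<open>z^l\<close>: the squares turn \<open>x\<close> and
    \<open>y\<close> into their inverses.\<close>
  have yx: "y \<otimes> x = inv x \<otimes> inv y \<otimes> z [^] (l + k)"
  proof -
    have "y \<otimes> x = x \<otimes> (y \<otimes> (inv y \<otimes> inv x \<otimes> y \<otimes> x))" by (simp add: word_simps)
    also have "inv y \<otimes> inv x \<otimes> y \<otimes> x = A \<otimes> inv B \<otimes> z [^] k" using comm by (simp add: grp_comm_def)
    also have "x \<otimes> (y \<otimes> (A \<otimes> inv B \<otimes> z [^] k)) = x \<otimes> (y \<otimes> A \<otimes> inv y) \<otimes> y \<otimes> inv B \<otimes> z [^] k"
      by (simp add: word_simps)
    also have "y \<otimes> A \<otimes> inv y = inv A \<otimes> z [^] l" using yA by (simp add: grp_conj_def)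
    also have "x \<otimes> (inv A \<otimes> z [^] l) \<otimes> y \<otimes> inv B \<otimes> z [^] k = inv x \<otimes> (z [^] l \<otimes> inv y) \<otimes> z [^] k"
      by (simp add: A_def B_def numeral_2_eq_2 word_simps)
    also have "z [^] l \<otimes> inv y = inv y \<otimes> z [^] l"
      using z_comm(2)[of l "-1"] by (simp add: int_pow_neg)
    finally show ?thesis by (simp add: m_assoc nat_pow_mult)
  qed
  have zl_sq: "(z [^] l) \<otimes> (z [^] l) = \<one>" by (simp add: zz flip: pow_mult_distrib)
  define t where "t = i div 2"
  have "x [^] (2 * t) = A [^] t"
    by (simp add: A_def int_pow_pow flip: int_pow_int)
  have "\<exists>(q::nat). y \<otimes> A [^] t = x [^] (- 2 * t) \<otimes> z [^] q \<otimes> y"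
  proof -
    have "grp_conj G (A [^] t) (inv y) = (inv A \<otimes> z [^] l) [^] t"
      by (simp add: grp_conj_int_pow yA)
    also have "\<dots> = inv A [^] t \<otimes> (z [^] l) [^] t"
      using z_comm(1)[of l "-2"] by (intro int_pow_mult_distrib) (simp_all add: A_def int_pow_minus_two)
    also have "inv A [^] t = x [^] (- 2 * t)"
      by (simp add: A_def int_pow_pow flip: int_pow_minus_two)
    also obtain q :: nat where "(z [^] l) [^] t = z [^] q"
    proof (cases t rule: int_cases2)
      case (nonneg r)
      then show ?thesis using that[of "l * r"] by (simp add: int_pow_int nat_pow_pow)
    next
      case (nonpos r)
      have "inv (z [^] l) = z [^] l" using zl_sq by (simp add: inv_equality)
      moreover have "(z [^] l) [^] t = inv (z [^] l) [^] r"
        unfolding nonpos by (simp add: int_pow_neg_int nat_pow_inv)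
      ultimately have "(z [^] l) [^] t = z [^] (l * r)" by (simp only: nat_pow_pow AB)
      then show ?thesis by (rule that)
    qed
    finally have "y \<otimes> A [^] t \<otimes> inv y = x [^] (- 2 * t) \<otimes> z [^] q" by (simp add: grp_conj_def)
    then have "y \<otimes> A [^] t \<otimes> inv y \<otimes> y = x [^] (- 2 * t) \<otimes> z [^] q \<otimes> y" by simp
    then show ?thesis by (intro exI[of _ q]) (simp add: m_assoc)
  qed
  then obtain q :: nat where q: "y \<otimes> A [^] t = x [^] (- 2 * t) \<otimes> z [^] q \<otimes> y" by blast
  have "\<exists>(u::int) (v::int). y \<otimes> x [^] i = x [^] u \<otimes> y [^] v"
  proof (cases "even i")
    case True
    then have "y \<otimes> x [^] i = x [^] (- 2 * t) \<otimes> z [^] q \<otimes> y"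
      using q \<open>x [^] (2 * t) = A [^] t\<close> by (simp add: t_def)
    also have "\<dots> = x [^] (- 2 * t + int (m * q)) \<otimes> y [^] (int (m * q) + 1)"
      unfolding zq by (simp only: m_assoc int_pow_mult int_pow_1 x y int_pow_closed m_closed)
    finally show ?thesis by blast
  next
    case False
    then have i: "i = 2 * t + 1" by (simp add: t_def)
    have "y \<otimes> x [^] i = y \<otimes> A [^] t \<otimes> x"
      by (simp add: i m_assoc int_pow_mult \<open>x [^] (2 * t) = A [^] t\<close>)
    also have "\<dots> = x [^] (- 2 * t) \<otimes> z [^] q \<otimes> (inv x \<otimes> inv y \<otimes> z [^] (l + k))"
      by (simp add: q m_assoc yx)
    also have "\<dots> = x [^] (- 2 * t) \<otimes> (z [^] q \<otimes> x [^] (-1::int)) \<otimes> (y [^] (-1::int) \<otimes> z [^] (l + k))"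
      by (simp add: int_pow_neg m_assoc)
    also have "\<dots> = x [^] (- 2 * t) \<otimes> (x [^] (-1::int) \<otimes> z [^] q) \<otimes> (z [^] (l + k) \<otimes> y [^] (-1::int))"
      by (simp only: z_comm)
    also have "\<dots> = x [^] (- 2 * t) \<otimes> x [^] (-1::int) \<otimes> z [^] (q + (l + k)) \<otimes> y [^] (-1::int)"
      by (simp only: nat_pow_mult[symmetric] m_assoc AB x y int_pow_closed nat_pow_closed m_closed)
    also have "\<dots> = x [^] (- 2 * t + -1 + int (m * (q + (l + k)))) \<otimes> y [^] (int (m * (q + (l + k))) + -1)"
      unfolding zq by (simp only: m_assoc int_pow_mult x y int_pow_closed m_closed)
    finally show ?thesis by blast
  qed
  then obtain u v :: int where "y \<otimes> x [^] i = x [^] u \<otimes> y [^] v" by blast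
  then have "y \<otimes> (x [^] i \<otimes> y [^] j) = x [^] u \<otimes> y [^] (v + j)"
    by (simp add: int_pow_mult flip: m_assoc)
  then show ?thesis by blast
qed



lemma (in group) int_pow_eq_nat_pow:
  assumes "x \<in> carrier G" "x [^] n = \<one>" "n > 0"
  shows "x [^] (u::int) = x [^] nat (u mod int n)"
proof -
  have "x [^] u = x [^] (int n * (u div int n) + u mod int n)" by simp
  also have "\<dots> = x [^] (u mod int n)"
    using assms by (simp only: int_pow_mult int_pow_pow[symmetric] int_pow_int int_pow_one l_one int_pow_closed)
  also have "\<dots> = x [^] nat (u mod int n)"
    using assms by (simp flip: int_pow_int)
  finally show ?thesis .
qed

section \<open>Relators under homomorphisms, and the kernel of the presentation map\<close>

lemma G2_rels_closed: "G2_rels e k l \<subseteq> carrier free_group \<times> carrier free_group"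
proof -
  interpret F: group free_group by (rule group_free_group)
  show ?thesis by (simp add: G2_rels_def Let_def grp_conj_def)
qed

lemma order4_rels_closed: "order4_rels \<subseteq> carrier free_group \<times> carrier free_group"
proof -
  interpret F: group free_group by (rule group_free_group)
  show ?thesis by (simp add: order4_rels_def Let_def)
qed

lemma hom_G2_rels_iff:
  assumes "group_hom free_group H h"
  shows "(\<forall>(u, v)\<in>G2_rels e k l. h u = h v) \<longleftrightarrow>
    G2_type H (2 ^ e) k l (h (free_gen Gen_a)) (h (free_gen Gen_b))"
proof -
  interpret group_hom free_group H h by fact
  show ?thesis
    by (simp add: G2_rels_def G2_type_def Let_def hom_grp_comm hom_grp_conj hom_nat_pow hom_int_pow)
qed

text \<open>When fourth powers vanish, squares are their own inverses, so inverting a square by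
  conjugation means centralizing it. The relation between \<open>b^2\<close> and \<open>a^2\<close>
  then follows from \<open>b^2\<close> commuting with \<open>a\<close>.\<close>

lemma hom_order4_rels_iff:
  assumes "group_hom free_group H h"
  shows "(\<forall>(u, v)\<in>order4_rels. h u = h v) \<longleftrightarrow>
    G2_type H 4 0 0 (h (free_gen Gen_a)) (h (free_gen Gen_b))"
proof -
  interpret group_hom free_group H h by fact
  define x y where "x = h (free_gen Gen_a)" and "y = h (free_gen Gen_b)"
  have xy: "x \<in> carrier H" "y \<in> carrier H" by (simp_all add: x_def y_def)
  have "(\<forall>(u, v)\<in>order4_rels. h u = h v) \<longleftrightarrow>
      x [^]\<^bsub>H\<^esub> (4::nat) = \<one>\<^bsub>H\<^esub> \<and> y [^]\<^bsub>H\<^esub> (4::nat) = \<one>\<^bsub>H\<^esub> \<and>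
      grp_conj H (x [^]\<^bsub>H\<^esub> (2::nat)) y = x [^]\<^bsub>H\<^esub> (2::nat) \<and>
      grp_conj H (y [^]\<^bsub>H\<^esub> (2::nat)) x = y [^]\<^bsub>H\<^esub> (2::nat) \<and>
      grp_comm H y x = x [^]\<^bsub>H\<^esub> (2::nat) \<otimes>\<^bsub>H\<^esub> y [^]\<^bsub>H\<^esub> (2::nat)"
    by (simp add: order4_rels_def Let_def hom_grp_comm hom_nat_pow x_def y_def
        H.grp_comm_eq_one_iff)
  also have "\<dots> \<longleftrightarrow> G2_type H 4 0 0 x y"
  proof -
    have inv: "inv\<^bsub>H\<^esub> (g [^]\<^bsub>H\<^esub> (2::nat)) = g [^]\<^bsub>H\<^esub> (2::nat)"
      if "g \<in> carrier H" "g [^]\<^bsub>H\<^esub> (4::nat) = \<one>\<^bsub>H\<^esub>" for g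
      using that by (intro H.inv_equality) (simp_all add: H.nat_pow_mult)
    have "grp_conj H (y [^]\<^bsub>H\<^esub> (2::nat)) (x [^]\<^bsub>H\<^esub> (2::nat)) = y [^]\<^bsub>H\<^esub> (2::nat)"
      if "grp_conj H (y [^]\<^bsub>H\<^esub> (2::nat)) x = y [^]\<^bsub>H\<^esub> (2::nat)"
      using that xy by (simp add: numeral_2_eq_2 flip: H.grp_conj_conj)
    then show ?thesis
      using xy inv[OF xy(1)] inv[OF xy(2)]
      by (auto simp: G2_type_def Let_def H.int_pow_minus_two H.grp_comm_eq_one_iff)
  qed
  finally show ?thesis by (simp only: x_def y_def)
qed

text \<open>No count of the presented group is made: an element of the kernel has a normal form
  \<open>x^i y^j\<close>, its image \<open>a^i b^j = 1\<close> forces \<open>n\<close> to divide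
  both exponents, and then the normal form is trivial. \<open>R\<close> is kept abstract to cover
  \<open>order4_rels\<close> as well.\<close>

lemma (in isobicyclic) has_presentation_of_G2_type:
  assumes R: "R \<subseteq> carrier free_group \<times> carrier free_group"
    and G2: "G2_type G n k l a b" and n: "4 dvd n" "l = 0 \<or> 8 dvd n"
    and satG: "\<And>h. group_hom free_group G h \<Longrightarrow>
      G2_type G n k l (h (free_gen Gen_a)) (h (free_gen Gen_b)) \<Longrightarrow> \<forall>(u, v)\<in>R. h u = h v"
    and satP: "\<And>h. group_hom free_group (presented_group R) h \<Longrightarrow> \<forall>(u, v)\<in>R. h u = h v \<Longrightarrow>
      G2_type (presented_group R) n k l (h (free_gen Gen_a)) (h (free_gen Gen_b))"
  shows "has_presentation G (case_gen a b) R"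
proof (rule has_presentationI[OF is_group _ R])
  show "case_gen a b x \<in> carrier G" for x by (cases x) simp_all
next
  fix \<psi> u v
  assume "group_hom free_group G \<psi>" "\<And>x. \<psi> (free_gen x) = case_gen a b x" "(u, v) \<in> R"
  then show "\<psi> u = \<psi> v" using satG[of \<psi>] G2 by auto
next
  fix \<psi>
  assume "group_hom free_group G \<psi>" and gen: "\<And>x. \<psi> (free_gen x) = case_gen a b x"
  then interpret \<psi>: group_hom free_group G \<psi> by simp
  show "carrier G \<subseteq> \<psi> ` carrier free_group"
  proof
    fix x assume "x \<in> carrier G"
    then obtain i j :: nat where "x = a [^] i \<otimes> b [^] j" using factorization by blast
    then have "x = \<psi> (free_gen Gen_a [^]\<^bsub>free_group\<^esub> i \<otimes>\<^bsub>free_group\<^esub> free_gen Gen_b [^]\<^bsub>free_group\<^esub> j)"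
      by (simp add: gen \<psi>.hom_nat_pow)
    then show "x \<in> \<psi> ` carrier free_group" by (rule image_eqI) simp
  qed
next
  fix \<psi> V
  let ?N = "normal_closure free_group (relators R)"
  let ?ga = "free_gen Gen_a" and ?gb = "free_gen Gen_b"
  assume "group_hom free_group G \<psi>" and gen: "\<And>x. \<psi> (free_gen x) = case_gen a b x"
    and kill: "\<And>V. V \<in> ?N \<Longrightarrow> \<psi> V = \<one>"
    and V: "V \<in> carrier free_group" "\<psi> V = \<one>"
  then interpret \<psi>: group_hom free_group G \<psi> by simp
  define \<pi> where "\<pi> = (\<lambda>V. ?N #>\<^bsub>free_group\<^esub> V)"
  interpret \<pi>: group_hom free_group "presented_group R" \<pi>
    unfolding \<pi>_def by (rule hom_presented_group(1)[OF R])
  let ?P = "presented_group R"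
  have N: "subgroup ?N free_group" by (rule hom_presented_group(3)[OF R])
  define x y where "x = \<pi> ?ga" and "y = \<pi> ?gb"
  have xy [simp]: "x \<in> carrier ?P" "y \<in> carrier ?P" by (simp_all add: x_def y_def)
  have P: "G2_type ?P n k l x y"
    unfolding x_def y_def
    by (rule satP[OF \<pi>.group_hom_axioms]) (use hom_presented_group(2)[OF R] in \<open>auto simp: \<pi>_def\<close>)
  then have xn: "x [^]\<^bsub>?P\<^esub> n = \<one>\<^bsub>?P\<^esub>" "y [^]\<^bsub>?P\<^esub> n = \<one>\<^bsub>?P\<^esub>"
    by (simp_all add: G2_type_def Let_def)
  have y_step: "\<exists>(u::int) (v::int). y [^]\<^bsub>?P\<^esub> r \<otimes>\<^bsub>?P\<^esub> (x [^]\<^bsub>?P\<^esub> (i::int) \<otimes>\<^bsub>?P\<^esub> y [^]\<^bsub>?P\<^esub> (j::int))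
      = x [^]\<^bsub>?P\<^esub> u \<otimes>\<^bsub>?P\<^esub> y [^]\<^bsub>?P\<^esub> v" for r :: nat and i j
  proof (induction r arbitrary: i j)
    case 0
    then show ?case by auto
  next
    case (Suc r)
    obtain u v :: int where uv: "y \<otimes>\<^bsub>?P\<^esub> (x [^]\<^bsub>?P\<^esub> i \<otimes>\<^bsub>?P\<^esub> y [^]\<^bsub>?P\<^esub> j) = x [^]\<^bsub>?P\<^esub> u \<otimes>\<^bsub>?P\<^esub> y [^]\<^bsub>?P\<^esub> v"
      using \<pi>.G2_type_normal_form[OF xy P n] by blast
    have "y [^]\<^bsub>?P\<^esub> Suc r \<otimes>\<^bsub>?P\<^esub> (x [^]\<^bsub>?P\<^esub> i \<otimes>\<^bsub>?P\<^esub> y [^]\<^bsub>?P\<^esub> j)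
        = y [^]\<^bsub>?P\<^esub> r \<otimes>\<^bsub>?P\<^esub> (x [^]\<^bsub>?P\<^esub> u \<otimes>\<^bsub>?P\<^esub> y [^]\<^bsub>?P\<^esub> v)"
      by (simp add: \<pi>.m_assoc flip: uv)
    then show ?case using Suc.IH[of u v] by simp
  qed
  \<comment> \<open>Prefixing an inverse letter thus reduces to prefixing \<open>y\<close>
    repeatedly.\<close>
  have inv_y: "inv\<^bsub>?P\<^esub> y = y [^]\<^bsub>?P\<^esub> (n - 1)"
    using xn n_pos by (intro \<pi>.inv_equality) (simp_all add: \<pi>.nat_pow_Suc[symmetric] del: \<pi>.nat_pow_Suc)
  have "\<exists>(u::int) (v::int). \<pi> V = x [^]\<^bsub>?P\<^esub> u \<otimes>\<^bsub>?P\<^esub> y [^]\<^bsub>?P\<^esub> v"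
    using V(1)
  proof (induction rule: free_group_induct)
    case one
    show ?case by (intro exI[of _ "0::int"]) simp
  next
    case (gen g V)
    then obtain u v :: int where uv: "\<pi> V = x [^]\<^bsub>?P\<^esub> u \<otimes>\<^bsub>?P\<^esub> y [^]\<^bsub>?P\<^esub> v" by blast
    show ?case
    proof (cases g)
      case Gen_a
      have "\<pi> (free_gen g \<otimes>\<^bsub>free_group\<^esub> V) = x [^]\<^bsub>?P\<^esub> (1 + u) \<otimes>\<^bsub>?P\<^esub> y [^]\<^bsub>?P\<^esub> v"
        using gen(1) by (simp add: Gen_a uv \<pi>.m_assoc \<pi>.int_pow_mult flip: x_def)
      then show ?thesis by blast
    next
      case Gen_b
      then show ?thesis using gen(1) y_step[of 1 u v] by (simp add: uv flip: y_def)
    qed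
  next
    case (inv_gen g V)
    then obtain u v :: int where uv: "\<pi> V = x [^]\<^bsub>?P\<^esub> u \<otimes>\<^bsub>?P\<^esub> y [^]\<^bsub>?P\<^esub> v" by blast
    show ?case
    proof (cases g)
      case Gen_a
      have "\<pi> (inv\<^bsub>free_group\<^esub> free_gen g \<otimes>\<^bsub>free_group\<^esub> V) = x [^]\<^bsub>?P\<^esub> (-1 + u) \<otimes>\<^bsub>?P\<^esub> y [^]\<^bsub>?P\<^esub> v"
        using inv_gen(1)
        by (simp add: Gen_a uv \<pi>.m_assoc \<pi>.int_pow_mult \<pi>.int_pow_neg del: add_uminus_conv_diff uminus_add_conv_diff flip: x_def)
      then show ?thesis by blast
    next
      case Gen_b
      then show ?thesis using inv_gen(1) y_step[of "n - 1" u v] by (simp add: uv inv_y flip: y_def)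
    qed
  qed
  then obtain i j :: nat where ij: "\<pi> V = x [^]\<^bsub>?P\<^esub> i \<otimes>\<^bsub>?P\<^esub> y [^]\<^bsub>?P\<^esub> j"
    using \<pi>.int_pow_eq_nat_pow[OF xy(1) xn(1) n_pos] \<pi>.int_pow_eq_nat_pow[OF xy(2) xn(2) n_pos] by metis
  \<comment> \<open>\<open>W\<close> carries the normal form back to the free group: it differs from
    \<open>V\<close> by an element that \<psi> kills, so the exponents can be read off in
    \<open>G\<close>.\<close>
  define W where "W = ?ga [^]\<^bsub>free_group\<^esub> i \<otimes>\<^bsub>free_group\<^esub> ?gb [^]\<^bsub>free_group\<^esub> j"
  have W: "W \<in> carrier free_group" by (simp add: W_def)
  have "\<pi> V = \<pi> W" by (simp add: ij W_def \<pi>.hom_nat_pow x_def y_def)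
  then have "V \<in> ?N #>\<^bsub>free_group\<^esub> W"
    using \<psi>.rcos_self[OF V(1) N] by (simp add: \<pi>_def)
  then obtain U where U: "U \<in> ?N" "V = U \<otimes>\<^bsub>free_group\<^esub> W" by (auto simp: r_coset_def)
  then have "\<psi> V = \<psi> W" using W kill subgroup.mem_carrier[OF N] by simp
  then have "a [^] i \<otimes> b [^] j = \<one>" using V(2) by (simp add: W_def gen \<psi>.hom_nat_pow)
  then have "n dvd i" "n dvd j"
    using factorization_unique a_pow_eq_one_iff b_pow_eq_one_iff by blast+
  then have "x [^]\<^bsub>?P\<^esub> i = \<one>\<^bsub>?P\<^esub>" "y [^]\<^bsub>?P\<^esub> j = \<one>\<^bsub>?P\<^esub>"
    using xn by (auto elim!: dvdE simp flip: \<pi>.nat_pow_pow)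
  then have "\<pi> V = \<one>\<^bsub>?P\<^esub>" by (simp add: ij)
  then have "?N #>\<^bsub>free_group\<^esub> V = ?N" by (simp add: \<pi>_def presented_group_def)
  then show "V \<in> ?N" using \<psi>.coset_join1 V(1) N by blast
qed

lemma has_presentation_imp_iso:
  assumes "has_presentation G f R" "R \<subseteq> carrier free_group \<times> carrier free_group"
  shows "G \<cong> presented_group R"
  using assms group.iso_sym[OF group_presented_group[OF assms(2)]]
  by (auto simp: has_presentation_def is_iso_def)

theorem theorem4p1:
  fixes G :: "('a, 'm) monoid_scheme" and a b :: 'a and n e :: nat
  assumes "n = 2 ^ e" and "n \<ge> 4"
    and "isobicyclic_triple n G a b"
    and "\<not> metacyclic G"
  shows "(e = 2 \<longrightarrow>
            has_presentation G (case_gen a b) order4_rels \<and> G \<cong> G2 2 0 0) \<and>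
         (e \<ge> 3 \<longrightarrow>
            (\<exists>k\<in>{0, 1}. \<exists>l\<in>{0, 1}.
               has_presentation G (case_gen a b) (G2_rels e k l) \<and> G \<cong> G2 e k l))"
proof -
  have "e \<ge> 2"
  proof (rule ccontr)
    assume "\<not> e \<ge> 2"
    then have "e = 0 \<or> e = 1" by auto
    with assms(1,2) show False by auto
  qed
  obtain \<alpha> where "isobicyclic G n a b \<alpha>"
    using isobicyclic_triple_imp_isobicyclic assms by fastforce
  then interpret isobicyclic G n a b \<alpha> .
  obtain k l where kl: "k \<in> {0, 1}" "l \<in> {0, 1}" "e = 2 \<longrightarrow> k = 0 \<and> l = 0"
    and G2: "G2_type G n k l a b"
    using isobicyclic_dichotomy[of G e a b \<alpha>] isobicyclic_axioms \<open>e \<ge> 2\<close> assms(1,4)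
      metacyclic_of_cyclic_type by blast
  have 4: "4 dvd n" using le_imp_power_dvd[OF \<open>e \<ge> 2\<close>, of "2::nat"] assms(1) by simp
  have 8: "l = 0 \<or> 8 dvd n"
  proof (cases "e = 2")
    case False
    then have "3 \<le> e" using \<open>e \<ge> 2\<close> by simp
    then show ?thesis using le_imp_power_dvd[of 3 e "2::nat"] assms(1) by simp
  qed (use kl in simp)
  have pres: "has_presentation G (case_gen a b) (G2_rels e k l)"
    by (rule has_presentation_of_G2_type[OF G2_rels_closed G2 4 8])
       (simp_all add: hom_G2_rels_iff assms(1))
  moreover have "G \<cong> G2 e k l"
    using has_presentation_imp_iso[OF pres G2_rels_closed] by (simp add: G2_def)
  moreover have "has_presentation G (case_gen a b) order4_rels" if "e = 2"
  proof -
    have "G2_type G n 0 0 a b" "n = 4" using G2 kl that assms(1) by simp_all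
    then show ?thesis
      by (intro has_presentation_of_G2_type[OF order4_rels_closed, of 0 0])
         (simp_all add: hom_order4_rels_iff)
  qed
  ultimately show ?thesis using kl by auto
qed

end
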